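(* Let $r\ge1$, $b,\kappa\in\mathbb{R}$, let $(u_0,\rho_0)\in H^s(\mathbb{R})\times H^{s-2r+1}(\mathbb{R})$ with $s>2r+\frac12$, and let $(u,\rho)$ be the solution on $[0,T)$ of the Cauchy problem $$\begin{cases} m_t=\alpha u_x-bu_xm-um_x-\kappa\rho\rho_x,\quad m=(1-\partial_x^2)^ru,\\ \rho_t=-u\rho_x-(b-1)u_x\rho,\quad \alpha_t=0,\\ u(0,x)=u_0(x),\ \rho(0,x)=\rho_0(x),\end{cases}$$ where $T>0$ is the maximal existence time. Let $\varphi$ be the flow defined by $\varphi_t(t,x)=u(t,\varphi(t,x))$, $\varphi(0,x)=x$, and for each $t\in[0,T)$ let $\varphi^{-1}(t,\cdot)$ denote the inverse of the diffeomorphism $\varphi(t,\cdot)$ of $\mathbb{R}$. Then the following representation holds: $$\rho(t,x)=\rho_0\big(\varphi^{-1}(t,x)\big)\,e^{(1-b)\int_0^tu_x(s,x)\,ds},\qquad t\in[0,T)$$ (in the exponent, $s$ denotes the time variable of integration). Moreover, if $\rho_0=\rho(0,\cdot)$ is supported in the interval $[\beta_{\rho_0},\gamma_{\rho_0}]$, then $\rho$ remains compactly supported for all further times of its existence $t\in[0,T)$, with the support of $\rho(t,\cdot)$ contained in the interval $[\varphi(t,\beta_{\rho_0}),\varphi(t,\gamma_{\rho_0})]$.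
   Context: The operator $(1-\partial_x^2)^r$ is the Fourier multiplier with symbol $(1+\xi^2)^r$. The coefficient $\alpha=\alpha(x)$ is independent of time and is either constant or belongs to $H^{s-2r}(\mathbb{R})$; under these assumptions the Cauchy problem has a unique solution $(u,\rho)\in\big(\mathcal{C}([0,T);H^s)\cap\mathcal{C}^1([0,T);H^{s-1})\big)\times\big(\mathcal{C}([0,T);H^{s-2r+1})\cap\mathcal{C}^1([0,T);H^{s-2r})\big)$. The flow $\varphi$ exists uniquely, and $\varphi(t,\cdot)$ is an increasing diffeomorphism of $\mathbb{R}$ for each $t\in[0,T)$, with $\varphi_x(t,x)=\exp\left\{\int_0^tu_x(\tau,\varphi(\tau,x))\,d\tau\right\}>0$.
   Formalization: In the exponent, u_x is integrated along the characteristic, i.e. u_x(s, φ(s, φ^{-1}(t,x))), instead of at the fixed point x; the printed formula fails, e.g. for the stationary solution u=ρ=exp(-x²/2) with r=1, b=κ=0, α=(4-x²)exp(-x²/2). *)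

theory Defs
  imports "HOL-Analysis.Analysis"
begin

definition schwartz :: "(real \<Rightarrow> complex) \<Rightarrow> bool" where
  "schwartz \<psi> \<longleftrightarrow> (\<exists>D :: nat \<Rightarrow> real \<Rightarrow> complex.
      D 0 = \<psi> \<and>
      (\<forall>n x. (D n has_vector_derivative D (Suc n) x) (at x)) \<and>
      (\<forall>n k. bounded (range (\<lambda>x. x ^ k *\<^sub>R D n x))))"

text \<open>Convention: the Fourier transform of \<open>\<psi>\<close> at \<open>\<xi>\<close> is the integral of
  \<open>\<psi> x * exp (- \<i> * x * \<xi>)\<close>. A function \<open>g\<close> is the Fourier transform of \<open>f\<close> in the sense of
  tempered distributions if the pairing of \<open>g\<close> with \<open>\<psi>\<close> equals the pairing of \<open>f\<close> with the
  transform of \<open>\<psi>\<close>, for every Schwartz function \<open>\<psi>\<close>. Such a \<open>g\<close> is unique almost everywhere.\<close>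

definition schwartz_fourier :: "(real \<Rightarrow> complex) \<Rightarrow> real \<Rightarrow> complex" where
  "schwartz_fourier \<psi> \<xi> = (LINT x|lborel. \<psi> x * cis (- (x * \<xi>)))"

definition has_fourier :: "(real \<Rightarrow> real) \<Rightarrow> (real \<Rightarrow> complex) \<Rightarrow> bool" where
  "has_fourier f g \<longleftrightarrow>
     f \<in> borel_measurable borel \<and> g \<in> borel_measurable borel \<and>
     (\<forall>\<psi>. schwartz \<psi> \<longrightarrow>
        integrable lborel (\<lambda>x. complex_of_real (f x) * schwartz_fourier \<psi> x) \<and>
        integrable lborel (\<lambda>\<xi>. g \<xi> * \<psi> \<xi>) \<and>
        (LINT x|lborel. complex_of_real (f x) * schwartz_fourier \<psi> x) = (LINT \<xi>|lborel. g \<xi> * \<psi> \<xi>))"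

text \<open>For \<open>\<sigma> \<ge> 0\<close> this is the Sobolev space of order \<open>\<sigma>\<close> on the real line, its elements being
  represented by functions. Only orders above 1/2 occur below. (For \<open>\<sigma> < 0\<close> the definition would
  miss the elements that are not functions.)\<close>

definition sobolev :: "real \<Rightarrow> (real \<Rightarrow> real) set" where
  "sobolev \<sigma> = {f. \<exists>g. has_fourier f g \<and>
      integrable lborel (\<lambda>\<xi>. (1 + \<xi>\<^sup>2) powr \<sigma> * (cmod (g \<xi>))\<^sup>2)}"

definition sobolev_norm :: "real \<Rightarrow> (real \<Rightarrow> real) \<Rightarrow> real" where
  "sobolev_norm \<sigma> f =
     sqrt (LINT \<xi>|lborel. (1 + \<xi>\<^sup>2) powr \<sigma> * (cmod ((SOME g. has_fourier f g) \<xi>))\<^sup>2)"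

definition fourier_multiplier :: "(real \<Rightarrow> real) \<Rightarrow> (real \<Rightarrow> real) \<Rightarrow> (real \<Rightarrow> real) \<Rightarrow> bool" where
  "fourier_multiplier p f h \<longleftrightarrow>
     (\<exists>g. has_fourier f g \<and> has_fourier h (\<lambda>\<xi>. complex_of_real (p \<xi>) * g \<xi>))"

definition C0_sobolev :: "real \<Rightarrow> real set \<Rightarrow> (real \<Rightarrow> real \<Rightarrow> real) \<Rightarrow> bool" where
  "C0_sobolev \<sigma> I w \<longleftrightarrow>
     (\<forall>t\<in>I. w t \<in> sobolev \<sigma>) \<and>
     (\<forall>t\<in>I. ((\<lambda>\<tau>. sobolev_norm \<sigma> (\<lambda>x. w \<tau> x - w t x)) \<longlongrightarrow> 0) (at t within I))"

text \<open>\<open>w\<close> is continuously differentiable from \<open>I\<close> into the Sobolev space, with derivative \<open>w'\<close>.\<close>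

definition C1_sobolev ::
  "real \<Rightarrow> real set \<Rightarrow> (real \<Rightarrow> real \<Rightarrow> real) \<Rightarrow> (real \<Rightarrow> real \<Rightarrow> real) \<Rightarrow> bool" where
  "C1_sobolev \<sigma> I w w' \<longleftrightarrow>
     C0_sobolev \<sigma> I w \<and> C0_sobolev \<sigma> I w' \<and>
     (\<forall>t\<in>I. ((\<lambda>\<tau>. sobolev_norm \<sigma> (\<lambda>x. (w \<tau> x - w t x) / (\<tau> - t) - w' t x)) \<longlongrightarrow> 0)
                (at t within I))"

definition lifespan :: "ereal \<Rightarrow> real set" where
  "lifespan T = {t. 0 \<le> t \<and> ereal t < T}"

text \<open>\<open>u t\<close> and \<open>\<rho> t\<close> are the continuous representatives of elements of Sobolev spaces of order
  above 3/2, hence continuously differentiable, so \<open>deriv\<close> is the classical x-derivative.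

  The equation for \<open>m\<close> takes place in the Sobolev space of order \<open>s - 2 * r - 1\<close>, which may be
  negative, so \<open>m\<^sub>t\<close> and \<open>u * m\<^sub>x\<close> need not be functions and the equation is read in the sense of
  distributions in \<open>x\<close> for every \<open>t\<close>; the pairing of \<open>u * m\<^sub>x\<close> with \<open>\<psi>\<close> is by definition minus
  the pairing of \<open>m\<close> with the x-derivative of \<open>u * \<psi>\<close>. The equation for \<open>\<rho>\<close> is one between
  continuous functions. The equation \<open>\<alpha>\<^sub>t = 0\<close> is built in, \<open>\<alpha>\<close> being a function of \<open>x\<close> only.\<close>

definition cauchy_solution ::
  "real \<Rightarrow> real \<Rightarrow> real \<Rightarrow> real \<Rightarrow> (real \<Rightarrow> real) \<Rightarrow> (real \<Rightarrow> real) \<Rightarrow> (real \<Rightarrow> real) \<Rightarrow> ereal \<Rightarrow>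
   (real \<Rightarrow> real \<Rightarrow> real) \<Rightarrow> (real \<Rightarrow> real \<Rightarrow> real) \<Rightarrow> bool" where
  "cauchy_solution r b \<kappa> s \<alpha> u\<^sub>0 \<rho>\<^sub>0 T u \<rho> \<longleftrightarrow>
     (\<exists>u\<^sub>t \<rho>\<^sub>t m.
        C0_sobolev s (lifespan T) u \<and> C1_sobolev (s - 1) (lifespan T) u u\<^sub>t \<and>
        C0_sobolev (s - 2 * r + 1) (lifespan T) \<rho> \<and> C1_sobolev (s - 2 * r) (lifespan T) \<rho> \<rho>\<^sub>t \<and>
        (\<forall>t\<in>lifespan T. continuous_on UNIV (u t) \<and> continuous_on UNIV (\<rho> t)) \<and>
        (\<forall>t\<in>lifespan T. fourier_multiplier (\<lambda>\<xi>. (1 + \<xi>\<^sup>2) powr r) (u t) (m t)) \<and>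
        (\<forall>\<psi>. schwartz \<psi> \<longrightarrow> (\<forall>t\<in>lifespan T.
           ((\<lambda>\<tau>. LINT x|lborel. m \<tau> x *\<^sub>R \<psi> x) has_vector_derivative
              (LINT x|lborel. (\<alpha> x * deriv (u t) x - b * deriv (u t) x * m t x
                                 - \<kappa> * \<rho> t x * deriv (\<rho> t) x) *\<^sub>R \<psi> x)
              + (LINT x|lborel. m t x *\<^sub>R vector_derivative (\<lambda>y. u t y *\<^sub>R \<psi> y) (at x)))
             (at t within lifespan T))) \<and>
        (\<forall>t\<in>lifespan T. \<forall>x.
           \<rho>\<^sub>t t x = - u t x * deriv (\<rho> t) x - (b - 1) * deriv (u t) x * \<rho> t x) \<and>
        (\<forall>x. u 0 x = u\<^sub>0 x) \<and> (\<forall>x. \<rho> 0 x = \<rho>\<^sub>0 x))"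

text \<open>The maximal existence time may be \<open>\<infinity>\<close>.\<close>

definition maximal_cauchy_solution ::
  "real \<Rightarrow> real \<Rightarrow> real \<Rightarrow> real \<Rightarrow> (real \<Rightarrow> real) \<Rightarrow> (real \<Rightarrow> real) \<Rightarrow> (real \<Rightarrow> real) \<Rightarrow> ereal \<Rightarrow>
   (real \<Rightarrow> real \<Rightarrow> real) \<Rightarrow> (real \<Rightarrow> real \<Rightarrow> real) \<Rightarrow> bool" where
  "maximal_cauchy_solution r b \<kappa> s \<alpha> u\<^sub>0 \<rho>\<^sub>0 T u \<rho> \<longleftrightarrow>
     0 < T \<and> cauchy_solution r b \<kappa> s \<alpha> u\<^sub>0 \<rho>\<^sub>0 T u \<rho> \<and>
     \<not> (\<exists>T' u' \<rho>'. T < T' \<and> cauchy_solution r b \<kappa> s \<alpha> u\<^sub>0 \<rho>\<^sub>0 T' u' \<rho>' \<and>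
          (\<forall>t\<in>lifespan T. u' t = u t \<and> \<rho>' t = \<rho> t))"

definition is_flow :: "ereal \<Rightarrow> (real \<Rightarrow> real \<Rightarrow> real) \<Rightarrow> (real \<Rightarrow> real \<Rightarrow> real) \<Rightarrow> bool" where
  "is_flow T u \<phi> \<longleftrightarrow>
     (\<forall>x. \<phi> 0 x = x) \<and>
     (\<forall>t\<in>lifespan T. \<forall>x.
        ((\<lambda>\<tau>. \<phi> \<tau> x) has_real_derivative u t (\<phi> t x)) (at t within lifespan T))"

text \<open>In the representation of \<open>\<rho>\<close> the integral of \<open>u\<^sub>x\<close> in the exponent is taken along the
  characteristic that is at \<open>x\<close> at time \<open>t\<close>, that is, over \<open>u\<^sub>x(\<tau>, \<phi>(\<tau>, y))\<close> with
  \<open>y = \<phi>\<^sup>-\<^sup>1(t, x)\<close>. The integral of \<open>u\<^sub>x(\<tau>, x)\<close> at the fixed position \<open>x\<close>, which one also finds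
  written, gives a false formula: for \<open>r = 1\<close>, \<open>b = \<kappa> = 0\<close>, \<open>\<alpha>(x) = (4 - x\<^sup>2) exp(-x\<^sup>2/2)\<close> the
  functions \<open>u = \<rho> = exp(-x\<^sup>2/2)\<close> are a stationary solution, for which at \<open>x = 0\<close> that formula
  would read \<open>1 = u(\<phi>\<^sup>-\<^sup>1(t, 0))\<close>, whereas \<open>\<phi>\<^sup>-\<^sup>1(t, 0) < 0\<close> for \<open>t > 0\<close>.\<close>

definition supp :: "(real \<Rightarrow> real) \<Rightarrow> real set" where
  "supp f = closure {x. f x \<noteq> 0}"

end

theory Submission
  imports Defs "HOL-Probability.Levy" "HOL-Computational_Algebra.Polynomial"
    "HOL-Real_Asymp.Real_Asymp"
begin

text \<open>By Fourier inversion and Cauchy-Schwarz, a continuous element of the Sobolev space of order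
  \<open>\<sigma> > 1/2\<close> is bounded by its norm, and so is its derivative if \<open>\<sigma> > 3/2\<close>. Hence the difference
  quotients of \<open>\<rho>\<close> in time converge uniformly in \<open>x\<close>, which justifies the chain rule along a
  characteristic: \<open>\<rho>(t, \<phi>(t, y))\<close> solves the linear equation \<open>R' = (1 - b) u\<^sub>x(t, \<phi>(t, y)) R\<close>.
  Since \<open>u\<^sub>x\<close> is bounded on compact time intervals, Gronwall's inequality for the difference of two
  characteristics makes \<open>\<phi>(t, \<cdot>)\<close> an increasing bijection, so the formula on
  characteristics gives \<open>\<rho>\<close> everywhere and shows that its support is transported by \<open>\<phi>\<close>.\<close>

section \<open>Uniqueness for the Fourier transform\<close>

text \<open>A transform in the sense of \<open>has_fourier\<close> is known only through pairings
  with Schwartz functions, and \<open>sobolev_norm\<close> takes it from a choice operator. Before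
  any estimate it must therefore be shown unique almost everywhere, and a continuous function must
  be recovered from it pointwise. Gaussians are enough as test functions: modulated ones reduce
  uniqueness to an integrable function whose classical transform vanishes, translated ones have
  explicit transforms and reduce inversion to the same statement, and that statement comes from the
  uniqueness of characteristic functions of probability measures. The bound on \<open>s\<close>
  enters through three orders. The orders \<open>s\<close> of \<open>u\<close> and
  \<open>s - 2 * r + 1\<close> of \<open>\<rho>\<close> exceed 3/2, which gives continuous bounded
  x-derivatives; \<open>s - 2 * r\<close> exceeds 1/2, which is enough for the time difference
  quotients of \<open>\<rho>\<close>, since these are not differentiated in x.\<close>

lemma borel_measurable_cis_mult [measurable]: "(\<lambda>\<xi>. cis (x * \<xi>)) \<in> borel_measurable borel"
  by (intro borel_measurable_continuous_onI continuous_intros)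

lemma integrable_mult_cis:
  assumes "integrable lborel g"
  shows "integrable lborel (\<lambda>\<xi>. g \<xi> * cis (x * \<xi>))"
proof (rule Bochner_Integration.integrable_bound[OF assms])
  have [measurable]: "g \<in> borel_measurable borel" using assms by auto
  show "(\<lambda>\<xi>. g \<xi> * cis (x * \<xi>)) \<in> borel_measurable lborel" by measurable
qed (auto simp: norm_mult)

lemma AE_eq_0_if_fourier_0_real:
  fixes k :: "real \<Rightarrow> real"
  assumes k: "integrable lborel k"
    and zero: "\<And>a. (LINT x|lborel. complex_of_real (k x) * cis (a * x)) = 0"
  shows "AE x in lborel. k x = 0"
proof -
  txt \<open>The positive and the negative part of \<open>k\<close> have the same mass and, once normalised, the
    same characteristic function.\<close>
  define p q where "p x = max (k x) 0" and "q x = max (- k x) 0" for x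
  have [measurable]: "k \<in> borel_measurable borel"
    using k by auto
  have p: "integrable lborel p" and q: "integrable lborel q"
    unfolding p_def q_def using k by auto
  have [measurable]: "p \<in> borel_measurable borel" "q \<in> borel_measurable borel"
    unfolding p_def q_def by measurable
  have p0: "p x \<ge> 0" and q0: "q x \<ge> 0" and kpq: "k x = p x - q x" for x
    by (auto simp: p_def q_def)
  have ints: "integrable lborel (\<lambda>x. complex_of_real (f x) * cis (a * x))"
    if "integrable lborel f" for a and f :: "real \<Rightarrow> real"
    using that by (intro integrable_mult_cis) auto
  have eq: "(LINT x|lborel. complex_of_real (p x) * cis (a * x)) =
      (LINT x|lborel. complex_of_real (q x) * cis (a * x))" for a
  proof -
    have "(LINT x|lborel. complex_of_real (p x) * cis (a * x)) -
      (LINT x|lborel. complex_of_real (q x) * cis (a * x)) =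
      (LINT x|lborel. complex_of_real (k x) * cis (a * x))"
      by (subst Bochner_Integration.integral_diff[symmetric]) (simp_all add: ints p q kpq left_diff_distrib)
    then show ?thesis by (simp add: zero)
  qed
  define M where "M = (LINT x|lborel. p x)"
  have Mq: "M = (LINT x|lborel. q x)"
    using eq[of 0] by (simp add: M_def)
  show ?thesis
  \<comment> \<open>Normalising divides by \<open>M\<close>, so zero mass is treated apart: both
    parts are then nonnegative with integral 0.\<close>
  proof (cases "M = 0")
    case True
    have "AE x in lborel. p x = 0"
      using True p p0 by (subst integral_nonneg_eq_0_iff_AE[symmetric]) (auto simp: M_def)
    moreover have "AE x in lborel. q x = 0"
      using True q q0 Mq by (subst integral_nonneg_eq_0_iff_AE[symmetric]) auto
    ultimately show ?thesis by eventually_elim (simp add: kpq)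
  next
    case False
    moreover have "M \<ge> 0" unfolding M_def using p0 by simp
    ultimately have M: "M > 0" by simp
    have prob: "real_distribution (density lborel (\<lambda>x. ennreal (f x / M)))"
      if f: "integrable lborel f" "\<And>x. f x \<ge> 0" "(LINT x|lborel. f x) = M" for f
    proof -
      have [measurable]: "f \<in> borel_measurable borel" using f by auto
      have "emeasure (density lborel (\<lambda>x. ennreal (f x / M))) UNIV = (\<integral>\<^sup>+x. ennreal (f x / M) \<partial>lborel)"
        by (subst emeasure_density) auto
      also have "\<dots> = ennreal (LINT x|lborel. f x / M)"
        using f M by (intro nn_integral_eq_integral) auto
      also have "\<dots> = 1" using f M by simp
      finally show ?thesis
        by (intro real_distribution.intro prob_spaceI real_distribution_axioms.intro) auto
    qed
    have ch: "char (density lborel (\<lambda>x. ennreal (f x / M))) t =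
        (LINT x|lborel. complex_of_real (f x) * cis (t * x)) / M"
      if f: "integrable lborel f" "\<And>x. f x \<ge> 0" for f t
    proof -
      have [measurable]: "f \<in> borel_measurable borel" using f by auto
      have "char (density lborel (\<lambda>x. ennreal (f x / M))) t =
        (LINT x|lborel. (f x / M) *\<^sub>R iexp (t * x))"
        unfolding char_def using f M by (subst integral_density) auto
      also have "\<dots> = (LINT x|lborel. (complex_of_real (f x) * cis (t * x)) / M)"
        by (simp add: cis_conv_exp scaleR_conv_of_real)
      also have "\<dots> = (LINT x|lborel. (complex_of_real (f x) * cis (t * x))) / M"
        by simp
      finally show ?thesis .
    qed
    have "density lborel (\<lambda>x. ennreal (p x / M)) = density lborel (\<lambda>x. ennreal (q x / M))"
    proof (rule Levy_uniqueness)
      show "char (density lborel (\<lambda>x. ennreal (p x / M))) = char (density lborel (\<lambda>x. ennreal (q x / M)))"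
        using p q p0 q0 by (simp add: fun_eq_iff ch eq)
    qed (use prob p p0 q q0 Mq M_def in auto)
    then have "AE x in lborel. ennreal (p x / M) = ennreal (q x / M)"
      by (intro sigma_finite_measure.density_unique[OF lborel.sigma_finite_measure_axioms]) auto
    then show ?thesis
    proof eventually_elim
      case (elim x)
      then show ?case using M p0 q0 by (simp add: kpq)
    qed
  qed
qed

text \<open>The transform of \<open>cnj h\<close> at \<open>a\<close> is the conjugate of the
  transform of \<open>h\<close> at \<open>- a\<close>, so it vanishes too. Hence the transforms of
  the real and the imaginary part vanish, and the real case applies to each.\<close>

lemma AE_eq_0_if_fourier_0:
  fixes h :: "real \<Rightarrow> complex"
  assumes h: "integrable lborel h"
    and zero: "\<And>a. (LINT x|lborel. h x * cis (a * x)) = 0"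
  shows "AE x in lborel. h x = 0"
proof -
  note int = integrable_mult_cis[OF h]
  have cz: "(LINT x|lborel. cnj (h x) * cis (a * x)) = 0" for a
  proof -
    have "(LINT x|lborel. cnj (h x) * cis (a * x)) = (LINT x|lborel. cnj (h x * cis (- a * x)))"
      by (simp add: cis_cnj)
    also have "\<dots> = cnj (LINT x|lborel. h x * cis (- a * x))"
      by (rule Bochner_Integration.integral_cnj)
    also have "\<dots> = 0" using zero[of "- a"] by simp
    finally show ?thesis .
  qed
  have cint: "integrable lborel (\<lambda>x. cnj (h x) * cis (a * x))" for a
    using h by (intro integrable_mult_cis) auto
  have "AE x in lborel. Re (h x) = 0"
  proof (rule AE_eq_0_if_fourier_0_real)
    fix a
    have "(LINT x|lborel. complex_of_real (Re (h x)) * cis (a * x)) =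
      (LINT x|lborel. (h x * cis (a * x) + cnj (h x) * cis (a * x)) / 2)"
      by (intro Bochner_Integration.integral_cong refl) (simp add: complex_eq_iff algebra_simps)
    also have "\<dots> = 0" using int[of a] cint[of a] zero[of a] cz[of a] by simp
    finally show "(LINT x|lborel. complex_of_real (Re (h x)) * cis (a * x)) = 0" .
  qed (use h in auto)
  moreover have "AE x in lborel. Im (h x) = 0"
  proof (rule AE_eq_0_if_fourier_0_real)
    fix a
    have "(LINT x|lborel. complex_of_real (Im (h x)) * cis (a * x)) =
      (LINT x|lborel. (h x * cis (a * x) - cnj (h x) * cis (a * x)) / (2 * \<i>))"
    proof (intro Bochner_Integration.integral_cong refl)
      fix x
      have "h x * cis (a * x) - cnj (h x) * cis (a * x) = of_real (2 * Im (h x)) * \<i> * cis (a * x)"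
        by (metis complex_diff_cnj left_diff_distrib)
      then show "complex_of_real (Im (h x)) * cis (a * x) =
          (h x * cis (a * x) - cnj (h x) * cis (a * x)) / (2 * \<i>)"
        by (simp del: complex_i_mult_minus add: field_simps)
    qed
    also have "\<dots> = 0" using int[of a] cint[of a] zero[of a] cz[of a] by simp
    finally show "(LINT x|lborel. complex_of_real (Im (h x)) * cis (a * x)) = 0" .
  qed (use h in auto)
  ultimately show ?thesis by eventually_elim (simp add: complex_eq_iff)
qed

section \<open>Gaussians as Schwartz functions with explicit transform\<close>

lemma power_times_gauss_le:
  fixes a x :: real
  shows "\<bar>x\<bar> ^ k * exp (- x\<^sup>2 / 2 + a * x) \<le> fact k * exp ((\<bar>a\<bar> + 1)\<^sup>2 / 2)"
proof -
  \<comment> \<open>A single term of the exponential series is at most its sum.\<close>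
  have "\<bar>x\<bar> ^ k /\<^sub>R fact k \<le> (\<Sum>n. \<bar>x\<bar> ^ n /\<^sub>R fact n)"
    using sum_le_suminf[OF summable_exp_generic[of "\<bar>x\<bar>"], of "{k}"] by simp
  then have "\<bar>x\<bar> ^ k \<le> fact k * exp \<bar>x\<bar>"
    by (simp add: exp_def field_simps)
  then have "\<bar>x\<bar> ^ k * exp (- x\<^sup>2 / 2 + a * x) \<le> fact k * exp \<bar>x\<bar> * exp (- x\<^sup>2 / 2 + a * x)"
    by (intro mult_right_mono) auto
  also have "\<dots> = fact k * exp (\<bar>x\<bar> - x\<^sup>2 / 2 + a * x)"
    by (simp add: mult_exp_exp)
  also have "\<dots> \<le> fact k * exp ((\<bar>a\<bar> + 1)\<^sup>2 / 2)"
  proof -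
    have "a * x \<le> \<bar>a\<bar> * \<bar>x\<bar>" by (metis abs_ge_self abs_mult)
    \<comment> \<open>Completing the square; the linear coefficient is
      \<open>\<bar>a\<bar> + 1\<close> because the power has cost one factor
      \<open>exp \<bar>x\<bar>\<close>.\<close>
    moreover have "0 \<le> (\<bar>x\<bar> - (\<bar>a\<bar> + 1))\<^sup>2" by simp
    then have "(\<bar>a\<bar> + 1) * \<bar>x\<bar> - x\<^sup>2 / 2 \<le> (\<bar>a\<bar> + 1)\<^sup>2 / 2"
      by (simp add: power2_eq_square algebra_simps)
    ultimately have "\<bar>x\<bar> - x\<^sup>2 / 2 + a * x \<le> (\<bar>a\<bar> + 1)\<^sup>2 / 2"
      by (simp add: algebra_simps)
    then show ?thesis by simp
  qed
  finally show ?thesis .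
qed

text \<open>Complex parameters put all the needed test functions into one family:
  \<open>c = \<i> * a\<close>, \<open>d = 0\<close> is the standard Gaussian modulated by the
  frequency \<open>a\<close>, and \<open>c = a\<close>, \<open>d = - a\<^sup>2 / 2\<close> is its
  translate \<open>exp (- (x - a)\<^sup>2 / 2)\<close>.\<close>

definition gauss :: "complex \<Rightarrow> complex \<Rightarrow> real \<Rightarrow> complex" where
  "gauss c d x = exp (- (complex_of_real x)\<^sup>2 / 2 + c * complex_of_real x + d)"

lemma norm_gauss: "norm (gauss c d x) = exp (- x\<^sup>2 / 2 + Re c * x + Re d)"
  by (simp add: gauss_def power2_eq_square)

lemma continuous_on_gauss [continuous_intros]: "continuous_on A (gauss c d)"
  unfolding gauss_def by (intro continuous_intros) auto

lemma borel_measurable_gauss [measurable]: "gauss c d \<in> borel_measurable borel"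
  by (intro borel_measurable_continuous_onI continuous_intros)

lemma schwartz_gauss: "schwartz (gauss c d)"
proof -
  txt \<open>The derivatives are polynomials \<open>P n\<close> times the function itself.\<close>
  define P :: "nat \<Rightarrow> complex poly" where
    "P n = ((\<lambda>p. pderiv p + [:c, -1:] * p) ^^ n) 1" for n
  define D where "D n x = poly (P n) (of_real x) * gauss c d x" for n x
  have P_Suc: "P (Suc n) = pderiv (P n) + [:c, -1:] * P n" for n
    by (simp add: P_def)
  have dg: "(gauss c d has_vector_derivative (c - of_real x) * gauss c d x) (at x)" for x
  proof -
    have "((\<lambda>z. exp (- z\<^sup>2 / 2 + c * z + d)) has_field_derivative
        (c - of_real x) * gauss c d x) (at (of_real x))"
      unfolding gauss_def by (auto intro!: derivative_eq_intros simp: field_simps)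
    from has_vector_derivative_real_field[OF this] show ?thesis
      by (simp add: gauss_def[abs_def])
  qed
  have dp: "((\<lambda>x. poly p (of_real x)) has_vector_derivative poly (pderiv p) (of_real x)) (at x)"
    for p :: "complex poly" and x
    using has_vector_derivative_real_field[OF poly_DERIV[of p "of_real x"]] by simp
  have "(D n has_vector_derivative D (Suc n) x) (at x)" for n x
  proof -
    have "((\<lambda>x. poly (P n) (of_real x) * gauss c d x) has_vector_derivative
       (poly (P n) (of_real x) * ((c - of_real x) * gauss c d x) +
        poly (pderiv (P n)) (of_real x) * gauss c d x)) (at x)"
      by (rule has_vector_derivative_mult[OF dp dg])
    then show ?thesis unfolding D_def[abs_def] P_Suc by (simp add: algebra_simps)
  qed
  moreover have "bounded (range (\<lambda>x. x ^ k *\<^sub>R D n x))" for n k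
  proof -
    have "bounded (range (\<lambda>x. x ^ k *\<^sub>R (poly p (of_real x) * gauss c d x)))" for p
    \<comment> \<open>Since \<open>pCons a p\<close> is the constant \<open>a\<close> plus the
      variable times \<open>p\<close>, the second summand is the induction hypothesis for the
      exponent \<open>Suc k\<close>; hence \<open>k\<close> is arbitrary.\<close>
    proof (induction p arbitrary: k)
      case 0
      then show ?case by simp
    next
      case (pCons a p)
      have "bounded (range (\<lambda>x. x ^ k *\<^sub>R (a * gauss c d x)))"
      proof (rule boundedI)
        fix z assume "z \<in> range (\<lambda>x. x ^ k *\<^sub>R (a * gauss c d x))"
        then obtain x where z: "z = x ^ k *\<^sub>R (a * gauss c d x)" by auto
        have "norm z = norm a * exp (Re d) * (\<bar>x\<bar> ^ k * exp (- x\<^sup>2 / 2 + Re c * x))"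
          by (simp add: z norm_mult norm_gauss power_abs exp_add)
        also have "\<dots> \<le> norm a * exp (Re d) * (fact k * exp ((\<bar>Re c\<bar> + 1)\<^sup>2 / 2))"
          by (intro mult_left_mono power_times_gauss_le) auto
        finally show "norm z \<le> norm a * exp (Re d) * (fact k * exp ((\<bar>Re c\<bar> + 1)\<^sup>2 / 2))" .
      qed
      from bounded_plus_comp[OF this pCons.IH[of "Suc k"]] show ?case
        by (simp add: algebra_simps scaleR_conv_of_real)
    qed
    then show ?thesis unfolding D_def .
  qed
  moreover have "D 0 = gauss c d" by (simp add: D_def P_def fun_eq_iff)
  ultimately show ?thesis unfolding schwartz_def by blast
qed

text \<open>\<open>gauss 0 0\<close> is \<open>sqrt (2 * pi)\<close> times the standard normal
  density, so its transform is that multiple of the known characteristic function.\<close>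

lemma gauss_fourier_integral:
  "integrable lborel (\<lambda>x. gauss 0 0 x * cis (a * x))"
  "(LINT x|lborel. gauss 0 0 x * cis (a * x)) = sqrt (2 * pi) * exp (- a\<^sup>2 / 2)"
proof -
  have eq: "gauss 0 0 x * cis (a * x) = sqrt (2 * pi) * (std_normal_density x *\<^sub>R iexp (a * x))" for x
    using exp_of_real[of "- x\<^sup>2 / 2", where 'a = complex]
    by (simp add: gauss_def std_normal_density_def scaleR_conv_of_real cis_conv_exp)
  have int: "integrable lborel (\<lambda>x. std_normal_density x *\<^sub>R iexp (a * x))"
    by (rule Bochner_Integration.integrable_bound[OF integrable_normal_density[of 1 0]]) auto
  then show "integrable lborel (\<lambda>x. gauss 0 0 x * cis (a * x))"
    unfolding eq by (intro integrable_mult_right)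
  have "(LINT x|lborel. std_normal_density x *\<^sub>R iexp (a * x)) = char std_normal_distribution a"
    unfolding char_def by (subst integral_density) auto
  also have "\<dots> = exp (- a\<^sup>2 / 2)"
    by (simp add: char_std_normal_distribution)
  finally show "(LINT x|lborel. gauss 0 0 x * cis (a * x)) = sqrt (2 * pi) * exp (- a\<^sup>2 / 2)"
    unfolding eq integral_mult_right_zero by simp
qed

lemma gauss_split: "gauss (\<i> * of_real a) 0 x = gauss 0 0 x * cis (a * x)"
  by (simp add: gauss_def cis_conv_exp mult_exp_exp algebra_simps)

text \<open>Testing with the modulated Gaussians shows that the classical transform of
  \<open>(g - g') * gauss 0 0\<close> vanishes at every frequency. The Gaussian factor makes the
  product integrable and, having no zero, can be cancelled afterwards.\<close>

lemma has_fourier_AE_unique: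
  assumes "has_fourier f g" "has_fourier f g'"
  shows "AE x in lborel. g x = g' x"
proof -
  have int: "integrable lborel (\<lambda>x. k x * gauss c d x)" if "has_fourier f k" for c d k
    using that schwartz_gauss unfolding has_fourier_def by blast
  have eq: "(LINT x|lborel. g x * gauss c d x) = (LINT x|lborel. g' x * gauss c d x)" for c d
    using assms schwartz_gauss unfolding has_fourier_def by metis
  have "AE x in lborel. (g x - g' x) * gauss 0 0 x = 0"
  proof (rule AE_eq_0_if_fourier_0)
    show "integrable lborel (\<lambda>x. (g x - g' x) * gauss 0 0 x)"
      using int[OF assms(1)] int[OF assms(2)] by (simp add: left_diff_distrib)
    fix a
    have "(LINT x|lborel. (g x - g' x) * gauss 0 0 x * cis (a * x)) =
      (LINT x|lborel. g x * gauss (\<i> * of_real a) 0 x - g' x * gauss (\<i> * of_real a) 0 x)"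
      by (simp add: gauss_split algebra_simps)
    also have "\<dots> = 0"
      using int[OF assms(1)] int[OF assms(2)] eq by simp
    finally show "(LINT x|lborel. (g x - g' x) * gauss 0 0 x * cis (a * x)) = 0" .
  qed
  then show ?thesis by eventually_elim (auto simp: gauss_def)
qed

section \<open>Sobolev embedding on the real line\<close>

text \<open>The constant of Cauchy-Schwarz, divided by the factor of Fourier inversion.\<close>

definition sobolev_const :: "real \<Rightarrow> real" where
  "sobolev_const \<sigma> = sqrt (LINT \<xi>|lborel. (1 + \<xi>\<^sup>2) powr - \<sigma>) / (2 * pi)"

text \<open>The weight is compared on each half-line with a power of
  \<open>1 + \<bar>x\<bar>\<close>, which has an elementary antiderivative. Its exponent is
  \<open>- 2 * \<sigma>\<close>, so the antiderivative tends to 0 at infinity exactly because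
  \<open>\<sigma>\<close> exceeds 1/2.\<close>

lemma integrable_weight:
  assumes "\<sigma> > 1 / 2"
  shows "integrable lborel (\<lambda>\<xi>::real. (1 + \<xi>\<^sup>2) powr - \<sigma>)"
proof -
  \<comment> \<open>The factor \<open>2 powr \<sigma>\<close> comes from
    \<open>(1 + x)\<^sup>2 \<le> 2 * (1 + x\<^sup>2)\<close>. The negative half-line is covered by
    the reflection \<open>h (- x)\<close>.\<close>
  define h where "h x = 2 powr \<sigma> * (1 + x) powr (- 2 * \<sigma>)" for x :: real
  have [measurable]: "h \<in> borel_measurable borel" unfolding h_def by measurable
  have "(\<integral>\<^sup>+x. ennreal (h x) * indicator {0..} x \<partial>lborel) =
      ennreal (0 - 2 powr \<sigma> * (1 + 0) powr (1 - 2 * \<sigma>) / (1 - 2 * \<sigma>))"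
  proof (rule nn_integral_FTC_atLeast)
    fix x :: real assume "0 \<le> x"
    then show "DERIV (\<lambda>x. 2 powr \<sigma> * (1 + x) powr (1 - 2 * \<sigma>) / (1 - 2 * \<sigma>)) x :> h x"
      using assms DERIV_cdivide[OF DERIV_cmult[OF DERIV_fun_powr[of "\<lambda>x. 1 + x" 1 x "1 - 2 * \<sigma>"]],
          of "2 powr \<sigma>" "1 - 2 * \<sigma>"]
      by (auto simp: h_def intro!: derivative_eq_intros)
    show "0 \<le> h x" by (simp add: h_def)
  next
    have "1 - 2 * \<sigma> < 0" using assms by simp
    then show "((\<lambda>x. 2 powr \<sigma> * (1 + x) powr (1 - 2 * \<sigma>) / (1 - 2 * \<sigma>)) \<longlongrightarrow> 0) at_top"
      by real_asymp
  qed simp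
  then have fin: "(\<integral>\<^sup>+x. ennreal (h x) * indicator {0..} x \<partial>lborel) < \<infinity>"
    by simp
  have fin': "(\<integral>\<^sup>+x. ennreal (h (- x)) * indicator {0..} (- x) \<partial>lborel) < \<infinity>"
    using fin nn_integral_real_affine[of "\<lambda>x. ennreal (h x) * indicator {0..} x" "-1" 0] by simp
  have le: "ennreal ((1 + x\<^sup>2) powr - \<sigma>) \<le>
      ennreal (h x) * indicator {0..} x + ennreal (h (- x)) * indicator {0..} (- x)" for x :: real
  proof -
    have main: "(1 + x\<^sup>2) powr - \<sigma> \<le> h x" if "x \<ge> 0" for x :: real
    proof -
      have "(1 + x)\<^sup>2 \<le> 2 * (1 + x\<^sup>2)"
        using zero_le_power2[of "1 - x"] by (simp add: power2_eq_square algebra_simps)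
      then have "(2 * (1 + x\<^sup>2)) powr - \<sigma> \<le> ((1 + x)\<^sup>2) powr - \<sigma>"
        using assms that by (intro powr_mono2') auto
      also have "((1 + x)\<^sup>2) powr - \<sigma> = (1 + x) powr (- 2 * \<sigma>)"
        using that by (simp add: powr_powr powr_numeral[symmetric] del: powr_numeral)
      finally have "2 powr \<sigma> * (2 * (1 + x\<^sup>2)) powr - \<sigma> \<le> h x"
        by (simp add: h_def)
      also have "2 powr \<sigma> * (2 * (1 + x\<^sup>2)) powr - \<sigma> = (1 + x\<^sup>2) powr - \<sigma>"
      proof -
        have "(2 * (1 + x\<^sup>2)) powr - \<sigma> = 2 powr - \<sigma> * (1 + x\<^sup>2) powr - \<sigma>"
          by (rule powr_mult)
        then show ?thesis by (simp only: powr_minus) simp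
      qed
      finally show ?thesis .
    qed
    show ?thesis
    proof (cases "x \<ge> 0")
      case True
      then show ?thesis using main[of x]
        by (intro order_trans[OF _ add_increasing2[OF _ order_refl]]) (auto intro: ennreal_leI)
    next
      case False
      then show ?thesis using main[of "- x"]
        by (intro order_trans[OF _ add_increasing[OF _ order_refl]]) (auto intro: ennreal_leI)
    qed
  qed
  show ?thesis
  proof (rule integrableI_bounded)
    have "(\<integral>\<^sup>+x. ennreal (norm ((1 + x\<^sup>2) powr - \<sigma>)) \<partial>lborel) \<le>
      (\<integral>\<^sup>+x. (ennreal (h x) * indicator {0..} x + ennreal (h (- x)) * indicator {0..} (- x)) \<partial>lborel)"
      using le by (intro nn_integral_mono) simp
    also have "\<dots> = (\<integral>\<^sup>+x. ennreal (h x) * indicator {0..} x \<partial>lborel) +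
      (\<integral>\<^sup>+x. ennreal (h (- x)) * indicator {0..} (- x) \<partial>lborel)"
      by (rule nn_integral_add) auto
    also have "\<dots> < \<infinity>" using fin fin' by simp
    finally show "(\<integral>\<^sup>+x. ennreal (norm ((1 + x\<^sup>2) powr - \<sigma>)) \<partial>lborel) < \<infinity>" .
  qed simp
qed

text \<open>Cauchy-Schwarz for \<open>cmod (g \<xi>)\<close> written as the product of
  \<open>(1 + \<xi>\<^sup>2) powr (- \<sigma> / 2)\<close> and
  \<open>(1 + \<xi>\<^sup>2) powr (\<sigma> / 2) * cmod (g \<xi>)\<close>. It is applied to extended
  nonnegative integrals, where nothing has to be integrable beforehand, so that the integrability of
  \<open>g\<close> comes out as finiteness.\<close>

lemma weighted_L2_imp_L1:
  fixes g :: "real \<Rightarrow> complex"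
  assumes \<sigma>: "\<sigma> > 1 / 2" and [measurable]: "g \<in> borel_measurable borel"
    and int: "integrable lborel (\<lambda>\<xi>. (1 + \<xi>\<^sup>2) powr \<sigma> * (cmod (g \<xi>))\<^sup>2)"
  shows "integrable lborel g"
    and "(LINT \<xi>|lborel. cmod (g \<xi>)) \<le>
      2 * pi * sobolev_const \<sigma> * sqrt (LINT \<xi>|lborel. (1 + \<xi>\<^sup>2) powr \<sigma> * (cmod (g \<xi>))\<^sup>2)"
proof -
  note w = integrable_weight[OF \<sigma>]
  define A B where "A = (LINT \<xi>|lborel. (1 + \<xi>\<^sup>2) powr - \<sigma>)"
    and "B = (LINT \<xi>|lborel. (1 + \<xi>\<^sup>2) powr \<sigma> * (cmod (g \<xi>))\<^sup>2)"
  have sq: "((1 + \<xi>\<^sup>2) powr p)\<^sup>2 = (1 + \<xi>\<^sup>2) powr (2 * p)" for \<xi> p :: real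
    by (simp add: power2_eq_square powr_add[symmetric])
  have cs: "(\<integral>\<^sup>+\<xi>. ennreal (cmod (g \<xi>)) \<partial>lborel)\<^sup>2 \<le> ennreal A * ennreal B"
  proof -
    have "(\<integral>\<^sup>+\<xi>. ennreal ((1 + \<xi>\<^sup>2) powr (- \<sigma> / 2)) * ennreal ((1 + \<xi>\<^sup>2) powr (\<sigma> / 2) * cmod (g \<xi>)) \<partial>lborel)\<^sup>2
      \<le> (\<integral>\<^sup>+\<xi>. (ennreal ((1 + \<xi>\<^sup>2) powr (- \<sigma> / 2)))\<^sup>2 \<partial>lborel) *
        (\<integral>\<^sup>+\<xi>. (ennreal ((1 + \<xi>\<^sup>2) powr (\<sigma> / 2) * cmod (g \<xi>)))\<^sup>2 \<partial>lborel)"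
      by (rule Cauchy_Schwarz_nn_integral) auto
    also have "(\<integral>\<^sup>+\<xi>. (ennreal ((1 + \<xi>\<^sup>2) powr (- \<sigma> / 2)))\<^sup>2 \<partial>lborel) = ennreal A"
      unfolding A_def using w
      by (subst nn_integral_eq_integral[symmetric]) (auto simp: ennreal_power sq)
    also have "(\<integral>\<^sup>+\<xi>. (ennreal ((1 + \<xi>\<^sup>2) powr (\<sigma> / 2) * cmod (g \<xi>)))\<^sup>2 \<partial>lborel) = ennreal B"
      unfolding B_def using int
      by (subst nn_integral_eq_integral[symmetric]) (auto simp: ennreal_power sq power_mult_distrib)
    also have "(\<lambda>\<xi>. ennreal ((1 + \<xi>\<^sup>2) powr (- \<sigma> / 2)) * ennreal ((1 + \<xi>\<^sup>2) powr (\<sigma> / 2) * cmod (g \<xi>))) =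
        (\<lambda>\<xi>. ennreal (cmod (g \<xi>)))"
    proof
      fix \<xi> :: real
      have "1 + \<xi>\<^sup>2 \<noteq> 0" by (metis add_pos_nonneg less_irrefl zero_le_power2 zero_less_one)
      then show "ennreal ((1 + \<xi>\<^sup>2) powr (- \<sigma> / 2)) * ennreal ((1 + \<xi>\<^sup>2) powr (\<sigma> / 2) * cmod (g \<xi>)) =
        ennreal (cmod (g \<xi>))"
        by (simp add: ennreal_mult[symmetric] mult.assoc[symmetric] powr_add[symmetric])
    qed
    finally show ?thesis .
  qed
  have A0: "A \<ge> 0" and B0: "B \<ge> 0" unfolding A_def B_def by auto
  have fin: "(\<integral>\<^sup>+\<xi>. ennreal (cmod (g \<xi>)) \<partial>lborel) < \<infinity>"
  proof (rule ccontr)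
    assume "\<not> ?thesis"
    then have "(\<integral>\<^sup>+\<xi>. ennreal (cmod (g \<xi>)) \<partial>lborel) = \<infinity>" by (simp add: less_top[symmetric])
    then show False using cs A0 B0 by (simp add: ennreal_mult[symmetric] top_unique)
  qed
  then show i: "integrable lborel g" by (intro integrableI_bounded) auto
  have "ennreal ((LINT \<xi>|lborel. cmod (g \<xi>))\<^sup>2) = (\<integral>\<^sup>+\<xi>. ennreal (cmod (g \<xi>)) \<partial>lborel)\<^sup>2"
    using i by (subst nn_integral_eq_integral) (auto simp: ennreal_power)
  also note cs
  finally have "(LINT \<xi>|lborel. cmod (g \<xi>))\<^sup>2 \<le> A * B"
    using A0 B0 by (simp add: ennreal_mult[symmetric])
  then have "(LINT \<xi>|lborel. cmod (g \<xi>)) \<le> sqrt (A * B)"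
    by (rule real_le_rsqrt)
  then show "(LINT \<xi>|lborel. cmod (g \<xi>)) \<le>
      2 * pi * sobolev_const \<sigma> * sqrt (LINT \<xi>|lborel. (1 + \<xi>\<^sup>2) powr \<sigma> * (cmod (g \<xi>))\<^sup>2)"
    by (simp add: sobolev_const_def A_def B_def real_sqrt_mult)
qed

section \<open>Fourier integrals and inversion\<close>

lemma continuous_fourier_integral:
  assumes g: "integrable lborel g"
  shows "continuous_on UNIV (\<lambda>x. LINT \<xi>|lborel. g \<xi> * cis (x * \<xi>))"
proof -
  have [measurable]: "g \<in> borel_measurable borel" using g by auto
  have "((\<lambda>x. LINT \<xi>|lborel. g \<xi> * cis (x * \<xi>)) \<longlongrightarrow> (LINT \<xi>|lborel. g \<xi> * cis (x * \<xi>))) (at x)" for x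
    unfolding tendsto_at_iff_sequentially comp_def
  proof (intro allI impI)
    fix X :: "nat \<Rightarrow> real" assume X: "X \<longlonglongrightarrow> x"
    show "(\<lambda>i. LINT \<xi>|lborel. g \<xi> * cis (X i * \<xi>)) \<longlonglongrightarrow> (LINT \<xi>|lborel. g \<xi> * cis (x * \<xi>))"
    proof (rule integral_dominated_convergence[where w = "\<lambda>\<xi>. cmod (g \<xi>)"])
      show "AE \<xi> in lborel. (\<lambda>i. g \<xi> * cis (X i * \<xi>)) \<longlonglongrightarrow> g \<xi> * cis (x * \<xi>)"
        using X by (intro AE_I2 tendsto_intros)
    qed (use g in \<open>auto simp: norm_mult\<close>)
  qed
  then show ?thesis by (simp add: continuous_on_def)
qed

text \<open>This makes the difference quotients of \<open>cis (x * \<xi>)\<close> in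
  \<open>x\<close> at most \<open>\<bar>\<xi>\<bar>\<close> in modulus, the domination needed to
  differentiate a Fourier integral.\<close>

lemma norm_cis_diff_le: "cmod (cis a - cis b) \<le> \<bar>a - b\<bar>"
proof -
  have "cis a - cis b = cis b * (cis (a - b) - 1)"
    by (simp add: right_diff_distrib cis_mult)
  then have "cmod (cis a - cis b) = cmod (cis (a - b) - 1)"
    by (simp add: norm_mult)
  also have "\<dots> \<le> \<bar>a - b\<bar>"
    using iexp_approx1[of "a - b" 0] by (simp add: cis_conv_exp)
  finally show ?thesis .
qed

text \<open>Differentiation under the integral by dominated convergence, with majorant
  \<open>\<bar>\<xi>\<bar> * cmod (g \<xi>)\<close>. The real part is taken because the function to
  be represented is real.\<close>

lemma DERIV_fourier_integral:
  assumes g: "integrable lborel g" and xg: "integrable lborel (\<lambda>\<xi>. \<i> * of_real \<xi> * g \<xi>)"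
  shows "((\<lambda>x. Re (LINT \<xi>|lborel. g \<xi> * cis (x * \<xi>))) has_real_derivative
      Re (LINT \<xi>|lborel. \<i> * of_real \<xi> * g \<xi> * cis (x * \<xi>))) (at x)"
proof -
  have [measurable]: "g \<in> borel_measurable borel" using g by auto
  note ints = integrable_mult_cis[OF g] integrable_mult_cis[OF xg]
  have eq: "(Re (LINT \<xi>|lborel. g \<xi> * cis (y * \<xi>)) - Re (LINT \<xi>|lborel. g \<xi> * cis (x * \<xi>))) / (y - x) =
    (LINT \<xi>|lborel. (Re (g \<xi> * cis (y * \<xi>)) - Re (g \<xi> * cis (x * \<xi>))) / (y - x))" for y
    using ints by (simp del: times_complex.sel)
  have eq': "Re (LINT \<xi>|lborel. \<i> * of_real \<xi> * g \<xi> * cis (x * \<xi>)) =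
    (LINT \<xi>|lborel. Re (\<i> * of_real \<xi> * g \<xi> * cis (x * \<xi>)))"
    using ints by (simp del: times_complex.sel)
  show ?thesis
    unfolding has_field_derivative_iff eq eq' tendsto_at_iff_sequentially comp_def
  proof (intro allI impI)
    fix X :: "nat \<Rightarrow> real" assume X0: "\<forall>i. X i \<in> UNIV - {x}" and X: "X \<longlonglongrightarrow> x"
    show "(\<lambda>i. LINT \<xi>|lborel. (Re (g \<xi> * cis (X i * \<xi>)) - Re (g \<xi> * cis (x * \<xi>))) / (X i - x))
      \<longlonglongrightarrow> (LINT \<xi>|lborel. Re (\<i> * of_real \<xi> * g \<xi> * cis (x * \<xi>)))"
    proof (rule integral_dominated_convergence[where w = "\<lambda>\<xi>. cmod (\<i> * of_real \<xi> * g \<xi>)"])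
      show "AE \<xi> in lborel. (\<lambda>i. (Re (g \<xi> * cis (X i * \<xi>)) - Re (g \<xi> * cis (x * \<xi>))) / (X i - x))
          \<longlonglongrightarrow> Re (\<i> * of_real \<xi> * g \<xi> * cis (x * \<xi>))"
      proof (rule AE_I2)
        fix \<xi> :: real
        have "((\<lambda>y. Re (g \<xi> * cis (y * \<xi>))) has_real_derivative
            Re (\<i> * of_real \<xi> * g \<xi> * cis (x * \<xi>))) (at x)"
          by (auto intro!: derivative_eq_intros simp: algebra_simps)
        then show "(\<lambda>i. (Re (g \<xi> * cis (X i * \<xi>)) - Re (g \<xi> * cis (x * \<xi>))) / (X i - x))
          \<longlonglongrightarrow> Re (\<i> * of_real \<xi> * g \<xi> * cis (x * \<xi>))"
          using X0 X unfolding has_field_derivative_iff tendsto_at_iff_sequentially comp_def by blast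
      qed
      show "AE \<xi> in lborel. norm ((Re (g \<xi> * cis (X i * \<xi>)) - Re (g \<xi> * cis (x * \<xi>))) / (X i - x))
          \<le> cmod (\<i> * of_real \<xi> * g \<xi>)" for i
      proof (rule AE_I2)
        fix \<xi> :: real
        have "\<bar>Re (g \<xi> * cis (X i * \<xi>)) - Re (g \<xi> * cis (x * \<xi>))\<bar> =
          \<bar>Re (g \<xi> * (cis (X i * \<xi>) - cis (x * \<xi>)))\<bar>"
          by (simp add: algebra_simps)
        also have "\<dots> \<le> cmod (g \<xi> * (cis (X i * \<xi>) - cis (x * \<xi>)))"
          by (rule abs_Re_le_cmod)
        also have "\<dots> \<le> cmod (g \<xi>) * \<bar>X i * \<xi> - x * \<xi>\<bar>"
          unfolding norm_mult by (intro mult_left_mono norm_cis_diff_le) auto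
        also have "\<dots> = cmod (\<i> * of_real \<xi> * g \<xi>) * \<bar>X i - x\<bar>"
          by (simp add: norm_mult left_diff_distrib[symmetric] abs_mult)
        finally show "norm ((Re (g \<xi> * cis (X i * \<xi>)) - Re (g \<xi> * cis (x * \<xi>))) / (X i - x))
          \<le> cmod (\<i> * of_real \<xi> * g \<xi>)"
          using X0 by (simp add: field_simps del: times_complex.sel)
      qed
    qed (use xg in auto)
  qed
qed

lemma norm_fourier_integral_le:
  "cmod (LINT \<xi>|lborel. g \<xi> * cis (x * \<xi>)) \<le> (LINT \<xi>|lborel. cmod (g \<xi>))"
  using integral_norm_bound[of lborel "\<lambda>\<xi>. g \<xi> * cis (x * \<xi>)"] by (simp add: norm_mult)

text \<open>The test function is the standard Gaussian translated by \<open>a\<close>; substituting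
  \<open>a + y\<close> turns the translation into the phase \<open>cis (- a * x)\<close>.\<close>

lemma schwartz_fourier_gauss:
  "schwartz_fourier (gauss (of_real a) (of_real (- a\<^sup>2 / 2))) x =
    sqrt (2 * pi) * (gauss 0 0 x * cis (- a * x))"
proof -
  have eq: "gauss (of_real a) (of_real (- a\<^sup>2 / 2)) (a + 1 * y) = gauss 0 0 y" for y
    by (simp add: gauss_def power2_eq_square field_simps)
  have "schwartz_fourier (gauss (of_real a) (of_real (- a\<^sup>2 / 2))) x =
    (LINT y|lborel. gauss 0 0 y * cis (- ((a + y) * x)))"
    unfolding schwartz_fourier_def
    by (subst lborel_integral_real_affine[of 1 _ a]) (use eq in simp_all)
  also have "\<dots> = (LINT y|lborel. cis (- a * x) * (gauss 0 0 y * cis (- x * y)))"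
  proof (intro Bochner_Integration.integral_cong refl)
    fix y
    have "cis (- ((a + y) * x)) = cis (- a * x) * cis (- x * y)"
      by (simp add: cis_mult algebra_simps)
    then show "gauss 0 0 y * cis (- ((a + y) * x)) = cis (- a * x) * (gauss 0 0 y * cis (- x * y))"
      by simp
  qed
  also have "\<dots> = cis (- a * x) * (of_real (sqrt (2 * pi)) * of_real (exp (- (- x)\<^sup>2 / 2)))"
    unfolding integral_mult_right_zero gauss_fourier_integral(2) of_real_mult by simp
  also have "complex_of_real (exp (- (- x)\<^sup>2 / 2)) = gauss 0 0 x"
    using exp_of_real[of "- x\<^sup>2 / 2", where 'a = complex] by (simp add: gauss_def)
  finally show ?thesis by simp
qed

lemma fourier_inversion:
  assumes fg: "has_fourier f g" and g: "integrable lborel g" and f: "continuous_on UNIV f"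
  shows "complex_of_real (f x) = (LINT \<xi>|lborel. g \<xi> * cis (x * \<xi>)) / (2 * pi)"
proof -
  define F where "F x = (LINT \<xi>|lborel. g \<xi> * cis (x * \<xi>)) / (2 * pi)" for x
  \<comment> \<open>\<open>f\<close> is not assumed integrable, so it cannot be compared with the
    candidate \<open>F\<close> by classical transforms directly. The weight \<open>K\<close>, the
    transform of the untranslated Gaussian, makes both products integrable, and it has no
    zero.\<close>
  define K where "K x = sqrt (2 * pi) * gauss 0 0 x" for x
  have [measurable]: "g \<in> borel_measurable borel" using g by auto
  have [measurable]: "K \<in> borel_measurable borel" unfolding K_def by measurable
  have K: "integrable lborel K"
    using gauss_fourier_integral(1)[of 0] unfolding K_def by simp
  have F: "continuous_on UNIV F"
    unfolding F_def by (intro continuous_intros continuous_fourier_integral g) auto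
  then have [measurable]: "F \<in> borel_measurable borel" by (rule borel_measurable_continuous_onI)
  have sf: "schwartz_fourier (gauss (of_real a) (of_real (- a\<^sup>2 / 2))) x = K x * cis (- a * x)" for a x
    by (simp only: K_def schwartz_fourier_gauss mult.assoc)
  have fint: "integrable lborel (\<lambda>x. f x * (K x * cis (- a * x)))"
    and feq: "(LINT x|lborel. f x * (K x * cis (- a * x))) =
      (LINT \<xi>|lborel. g \<xi> * gauss (of_real a) (of_real (- a\<^sup>2 / 2)) \<xi>)" for a
    using fg schwartz_gauss[of "of_real a" "of_real (- a\<^sup>2 / 2)"]
    unfolding has_fourier_def sf[symmetric] by blast+
  define B where "B = (LINT \<xi>|lborel. cmod (g \<xi>)) / (2 * pi)"
  have Fint: "integrable lborel (\<lambda>x. F x * (K x * cis (- a * x)))" for a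
  proof (rule Bochner_Integration.integrable_bound)
    show "integrable lborel (\<lambda>x. B * cmod (K x))" using K by simp
    show "AE x in lborel. norm (F x * (K x * cis (- a * x))) \<le> norm (B * cmod (K x))"
      using norm_fourier_integral_le[of g]
      by (intro AE_I2) (auto simp: F_def B_def norm_mult norm_divide divide_simps mult_right_mono)
  qed measurable
  have Feq: "(LINT x|lborel. F x * (K x * cis (- a * x))) =
      (LINT \<xi>|lborel. g \<xi> * gauss (of_real a) (of_real (- a\<^sup>2 / 2)) \<xi>)" for a
  proof -
    define h where "h x \<xi> = g \<xi> * cis (x * \<xi>) / (2 * pi) * (K x * cis (- a * x))" for x \<xi>
    have "continuous_on UNIV (\<lambda>z. cis (fst z * snd z))" by (intro continuous_intros)
    \<comment> \<open>Fubini needs the kernel measurable in both variables jointly; here that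
      follows from its continuity.\<close>
    then have [measurable]: "(\<lambda>z. cis (fst z * snd z)) \<in> borel_measurable (lborel \<Otimes>\<^sub>M lborel)"
      using borel_measurable_continuous_onI[of "\<lambda>z. cis (fst z * snd z)"] by (simp add: borel_prod[symmetric] cong: measurable_cong_sets)
    have hn: "cmod (h x \<xi>) = cmod (g \<xi>) * (cmod (K x) / (2 * pi))" for x \<xi>
      by (simp add: h_def norm_mult norm_divide)
    have "integrable (lborel \<Otimes>\<^sub>M lborel) (\<lambda>(x, \<xi>). h x \<xi>)"
    proof (rule lborel_pair.Fubini_integrable)
      show "(\<lambda>(x, \<xi>). h x \<xi>) \<in> borel_measurable (lborel \<Otimes>\<^sub>M lborel)"
        unfolding h_def case_prod_beta by measurable
      show "integrable lborel (\<lambda>x. LINT \<xi>|lborel. norm (case (x, \<xi>) of (x, \<xi>) \<Rightarrow> h x \<xi>))"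
        using K by (simp add: hn)
      show "AE x in lborel. integrable lborel (\<lambda>\<xi>. case (x, \<xi>) of (x, \<xi>) \<Rightarrow> h x \<xi>)"
        unfolding h_def using integrable_mult_cis[OF g] by simp
    qed
    then have "(LINT \<xi>|lborel. LINT x|lborel. h x \<xi>) = (LINT x|lborel. LINT \<xi>|lborel. h x \<xi>)"
      by (rule lborel_pair.Fubini_integral)
    moreover have "(LINT \<xi>|lborel. h x \<xi>) = F x * (K x * cis (- a * x))" for x
      unfolding h_def F_def by simp
    \<comment> \<open>The inner integral over \<open>x\<close> is the transform of the standard
      Gaussian at \<open>\<xi> - a\<close>. The two factors \<open>sqrt (2 * pi)\<close>, one from
      \<open>K\<close> and one from this transform, cancel the \<open>2 * pi\<close> in
      \<open>F\<close>.\<close>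
    moreover have "(LINT x|lborel. h x \<xi>) = g \<xi> * gauss (of_real a) (of_real (- a\<^sup>2 / 2)) \<xi>" for \<xi>
    proof -
      have "h x \<xi> = g \<xi> * sqrt (2 * pi) / (2 * pi) * (gauss 0 0 x * cis ((\<xi> - a) * x))" for x
      proof -
        have "cis ((\<xi> - a) * x) = cis (x * \<xi>) * cis (- a * x)"
          by (simp add: cis_mult algebra_simps)
        then show ?thesis by (simp add: h_def K_def)
      qed
      then have "(LINT x|lborel. h x \<xi>) =
          g \<xi> * sqrt (2 * pi) / (2 * pi) * (of_real (sqrt (2 * pi)) * of_real (exp (- (\<xi> - a)\<^sup>2 / 2)))"
        by (simp only: integral_mult_right_zero gauss_fourier_integral(2) of_real_mult)
      also have "\<dots> = g \<xi> * (sqrt (2 * pi) * sqrt (2 * pi) / (2 * pi)) * exp (- (\<xi> - a)\<^sup>2 / 2)"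
        by (simp del: real_sqrt_mult_self)
      also have "(sqrt (2 * pi) * sqrt (2 * pi) / (2 * pi)) = 1" by simp
      also have "complex_of_real (exp (- (\<xi> - a)\<^sup>2 / 2)) = gauss (of_real a) (of_real (- a\<^sup>2 / 2)) \<xi>"
        unfolding exp_of_real[symmetric] gauss_def
        by (intro arg_cong[where f = exp]) (simp add: power2_eq_square field_simps)
      finally show ?thesis by simp
    qed
    ultimately show ?thesis by simp
  qed
  txt \<open>Pairing \<open>f - F\<close> with the transforms of all translates of one Gaussian gives the
    Fourier transform of \<open>(f - F) K\<close>.\<close>
  have "AE x in lborel. (f x - F x) * K x = 0"
  proof (rule AE_eq_0_if_fourier_0)
    show "integrable lborel (\<lambda>x. (f x - F x) * K x)"
      using fint[of 0] Fint[of 0] by (simp add: left_diff_distrib)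
    fix a
    have "(LINT x|lborel. (f x - F x) * K x * cis (a * x)) =
      (LINT x|lborel. f x * (K x * cis (- (- a) * x)) - F x * (K x * cis (- (- a) * x)))"
      by (simp add: algebra_simps)
    also have "\<dots> = 0"
      using fint[of "- a"] Fint[of "- a"] feq[of "- a"] Feq[of "- a"]
      by (subst Bochner_Integration.integral_diff) auto
    finally show "(LINT x|lborel. (f x - F x) * K x * cis (a * x)) = 0" .
  qed
  then have "AE x in lborel. x \<in> {x. complex_of_real (f x) = F x}"
    by eventually_elim (auto simp: K_def gauss_def)
  then have "AE x in lebesgue. x \<in> {x. complex_of_real (f x) = F x}"
    by (rule AE_completion)
  \<comment> \<open>A closed set of full Lebesgue measure is the whole line; by continuity of
    \<open>f\<close> and \<open>F\<close> this turns almost everywhere into everywhere.\<close>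
  moreover have "closed {x. complex_of_real (f x) = F x}"
    by (intro closed_Collect_eq continuous_intros f F)
  ultimately have "x \<in> {x. complex_of_real (f x) = F x}"
    by (intro mem_closed_if_AE_lebesgue)
  then show ?thesis by (simp add: F_def)
qed

text \<open>Membership provides some transform with finite weighted integral, whereas the norm uses
  the chosen one. Both agree almost everywhere, so the integral in the norm is a genuine one and not
  the default 0 of a non-integrable function.\<close>

lemma sobolev_some:
  assumes "f \<in> sobolev \<sigma>"
  shows "has_fourier f (SOME g. has_fourier f g)"
    and "integrable lborel (\<lambda>\<xi>. (1 + \<xi>\<^sup>2) powr \<sigma> * (cmod ((SOME g. has_fourier f g) \<xi>))\<^sup>2)"
proof -
  obtain g where g: "has_fourier f g"
    and int: "integrable lborel (\<lambda>\<xi>. (1 + \<xi>\<^sup>2) powr \<sigma> * (cmod (g \<xi>))\<^sup>2)"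
    using assms by (auto simp: sobolev_def)
  define k where "k = (SOME g. has_fourier f g)"
  have k: "has_fourier f k" unfolding k_def by (rule someI[where P = "has_fourier f", OF g])
  then have [measurable]: "k \<in> borel_measurable borel" by (simp add: has_fourier_def)
  have ae: "AE \<xi> in lborel. k \<xi> = g \<xi>" using k g by (rule has_fourier_AE_unique)
  have "integrable lborel (\<lambda>\<xi>. (1 + \<xi>\<^sup>2) powr \<sigma> * (cmod (k \<xi>))\<^sup>2)"
    by (rule integrable_cong_AE_imp[OF int]) (use ae in auto)
  with k show "has_fourier f (SOME g. has_fourier f g)"
    "integrable lborel (\<lambda>\<xi>. (1 + \<xi>\<^sup>2) powr \<sigma> * (cmod ((SOME g. has_fourier f g) \<xi>))\<^sup>2)"
    by (simp_all add: k_def)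
qed

lemma sobolev_sup_bound:
  assumes \<sigma>: "\<sigma> > 1 / 2" and f: "f \<in> sobolev \<sigma>" and cont: "continuous_on UNIV f"
  shows "\<bar>f x\<bar> \<le> sobolev_const \<sigma> * sobolev_norm \<sigma> f"
proof -
  define g where "g = (SOME g. has_fourier f g)"
  note g = sobolev_some[OF f, folded g_def]
  then have [measurable]: "g \<in> borel_measurable borel" by (simp add: has_fourier_def)
  note L1 = weighted_L2_imp_L1[OF \<sigma> _ g(2), simplified]
  have "\<bar>f x\<bar> = cmod (complex_of_real (f x))" by simp
  also have "\<dots> = cmod (LINT \<xi>|lborel. g \<xi> * cis (x * \<xi>)) / (2 * pi)"
    unfolding fourier_inversion[OF g(1) L1(1) cont] by (simp add: norm_divide norm_mult)
  also have "\<dots> \<le> (2 * pi * sobolev_const \<sigma> * sobolev_norm \<sigma> f) / (2 * pi)"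
    using norm_fourier_integral_le[of g x] L1(2)
    by (intro divide_right_mono) (simp_all add: sobolev_norm_def g_def[symmetric])
  finally show ?thesis by simp
qed

text \<open>The derivative is represented by \<open>k \<xi> = \<i> * \<xi> * g \<xi>\<close>. From
  \<open>\<xi>\<^sup>2 \<le> 1 + \<xi>\<^sup>2\<close>, the weighted integral of \<open>k\<close> of
  order \<open>\<sigma> - 1\<close> is at most that of \<open>g\<close> of order
  \<open>\<sigma>\<close>. Hence the constant has index \<open>\<sigma> - 1\<close>, and
  \<open>\<sigma> - 1 > 1 / 2\<close> is what makes \<open>k\<close> integrable.\<close>

lemma sobolev_C1:
  assumes \<sigma>: "\<sigma> > 3 / 2" and f: "f \<in> sobolev \<sigma>" and cont: "continuous_on UNIV f"
  shows "(f has_real_derivative deriv f x) (at x)"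
    and "continuous_on UNIV (deriv f)"
    and "\<bar>deriv f x\<bar> \<le> sobolev_const (\<sigma> - 1) * sobolev_norm \<sigma> f"
proof -
  define g where "g = (SOME g. has_fourier f g)"
  note g = sobolev_some[OF f, folded g_def]
  then have [measurable]: "g \<in> borel_measurable borel" by (simp add: has_fourier_def)
  define k where "k \<xi> = \<i> * of_real \<xi> * g \<xi>" for \<xi>
  have [measurable]: "k \<in> borel_measurable borel" unfolding k_def by measurable
  have le: "(1 + \<xi>\<^sup>2) powr (\<sigma> - 1) * (cmod (k \<xi>))\<^sup>2 \<le> (1 + \<xi>\<^sup>2) powr \<sigma> * (cmod (g \<xi>))\<^sup>2" for \<xi>
  proof -
    have pos: "1 + \<xi>\<^sup>2 > 0" by (simp add: add_pos_nonneg)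
    have "(1 + \<xi>\<^sup>2) powr (\<sigma> - 1) * (cmod (k \<xi>))\<^sup>2 = (1 + \<xi>\<^sup>2) powr (\<sigma> - 1) * \<xi>\<^sup>2 * (cmod (g \<xi>))\<^sup>2"
      by (simp add: k_def norm_mult power_mult_distrib)
    also have "\<dots> \<le> (1 + \<xi>\<^sup>2) powr (\<sigma> - 1) * (1 + \<xi>\<^sup>2) * (cmod (g \<xi>))\<^sup>2"
      by (intro mult_right_mono mult_left_mono) auto
    also have "(1 + \<xi>\<^sup>2) powr (\<sigma> - 1) * (1 + \<xi>\<^sup>2) = (1 + \<xi>\<^sup>2) powr \<sigma>"
      using pos by (simp add: powr_diff)
    finally show ?thesis .
  qed
  have kint: "integrable lborel (\<lambda>\<xi>. (1 + \<xi>\<^sup>2) powr (\<sigma> - 1) * (cmod (k \<xi>))\<^sup>2)"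
    by (rule Bochner_Integration.integrable_bound[OF g(2)]) (use le in auto)
  have g1: "integrable lborel g"
    by (rule weighted_L2_imp_L1(1)[OF _ _ g(2)]) (use \<sigma> in auto)
  have \<sigma>1: "\<sigma> - 1 > 1 / 2" using \<sigma> by simp
  note k1 = weighted_L2_imp_L1[OF \<sigma>1 _ kint, simplified]
  define G where "G x = Re (LINT \<xi>|lborel. k \<xi> * cis (x * \<xi>)) / (2 * pi)" for x
  have feq: "f = (\<lambda>x. Re (LINT \<xi>|lborel. g \<xi> * cis (x * \<xi>)) / (2 * pi))"
  proof
    fix x
    have "f x = Re (complex_of_real (f x))" by simp
    also have "\<dots> = Re ((LINT \<xi>|lborel. g \<xi> * cis (x * \<xi>)) / complex_of_real (2 * pi))"
      unfolding fourier_inversion[OF g(1) g1 cont] by simp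
    finally show "f x = Re (LINT \<xi>|lborel. g \<xi> * cis (x * \<xi>)) / (2 * pi)"
      by (simp only: Re_divide_of_real)
  qed
  have D: "(f has_real_derivative G x) (at x)" for x
    unfolding G_def k_def
    by (subst feq) (intro DERIV_cdivide DERIV_fourier_integral g1 k1[unfolded k_def])
  have dG: "deriv f = G" using D DERIV_imp_deriv by blast
  show "(f has_real_derivative deriv f x) (at x)" using D dG by simp
  show "continuous_on UNIV (deriv f)"
    unfolding dG G_def by (intro continuous_intros continuous_fourier_integral k1) auto
  have "\<bar>deriv f x\<bar> \<le> cmod (LINT \<xi>|lborel. k \<xi> * cis (x * \<xi>)) / (2 * pi)"
    unfolding dG G_def using abs_Re_le_cmod by (simp add: abs_mult divide_right_mono)
  also have "\<dots> \<le> (2 * pi * sobolev_const (\<sigma> - 1) * sobolev_norm \<sigma> f) / (2 * pi)"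
  proof (rule divide_right_mono)
    have "cmod (LINT \<xi>|lborel. k \<xi> * cis (x * \<xi>)) \<le> (LINT \<xi>|lborel. cmod (k \<xi>))"
      by (rule norm_fourier_integral_le)
    also note k1(2)
    also have "sqrt (LINT \<xi>|lborel. (1 + \<xi>\<^sup>2) powr (\<sigma> - 1) * (cmod (k \<xi>))\<^sup>2) \<le> sobolev_norm \<sigma> f"
      unfolding sobolev_norm_def g_def[symmetric]
      using kint g(2) le by (intro real_sqrt_le_mono integral_mono) auto
    finally show "cmod (LINT \<xi>|lborel. k \<xi> * cis (x * \<xi>)) \<le> 2 * pi * sobolev_const (\<sigma> - 1) * sobolev_norm \<sigma> f"
      by (simp add: sobolev_const_def mult_left_mono)
  qed simp
  finally show "\<bar>deriv f x\<bar> \<le> sobolev_const (\<sigma> - 1) * sobolev_norm \<sigma> f" by simp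
qed

text \<open>The pointwise bounds require membership in the space, and they will be applied to
  differences and difference quotients in time. The weighted integral is controlled by
  \<open>(p + q)\<^sup>2 \<le> 2 * p\<^sup>2 + 2 * q\<^sup>2\<close>.\<close>

lemma sobolev_lincomb:
  assumes f: "f \<in> sobolev \<sigma>" and h: "h \<in> sobolev \<sigma>"
  shows "(\<lambda>x. c * f x + d * h x) \<in> sobolev \<sigma>"
proof -
  obtain g where g: "has_fourier f g"
    and gi: "integrable lborel (\<lambda>\<xi>. (1 + \<xi>\<^sup>2) powr \<sigma> * (cmod (g \<xi>))\<^sup>2)"
    using f by (auto simp: sobolev_def)
  obtain k where k: "has_fourier h k"
    and ki: "integrable lborel (\<lambda>\<xi>. (1 + \<xi>\<^sup>2) powr \<sigma> * (cmod (k \<xi>))\<^sup>2)"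
    using h by (auto simp: sobolev_def)
  have [measurable]: "f \<in> borel_measurable borel" "g \<in> borel_measurable borel"
    "h \<in> borel_measurable borel" "k \<in> borel_measurable borel"
    using g k by (auto simp: has_fourier_def)
  define l where "l \<xi> = of_real c * g \<xi> + of_real d * k \<xi>" for \<xi>
  have [measurable]: "l \<in> borel_measurable borel" unfolding l_def by measurable
  have "has_fourier (\<lambda>x. c * f x + d * h x) l"
    unfolding has_fourier_def
  proof (intro conjI allI impI)
    fix \<psi> assume "schwartz \<psi>"
    note * = g[unfolded has_fourier_def, THEN conjunct2, THEN conjunct2, rule_format, OF this]
      k[unfolded has_fourier_def, THEN conjunct2, THEN conjunct2, rule_format, OF this]
    have 1: "complex_of_real (c * f x + d * h x) * z =
        complex_of_real c * (complex_of_real (f x) * z) + complex_of_real d * (complex_of_real (h x) * z)" for x z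
      by (simp add: algebra_simps)
    have 2: "l \<xi> * z = of_real c * (g \<xi> * z) + of_real d * (k \<xi> * z)" for \<xi> z
      by (simp add: l_def algebra_simps)
    show "integrable lborel (\<lambda>x. complex_of_real (c * f x + d * h x) * schwartz_fourier \<psi> x)"
      "integrable lborel (\<lambda>\<xi>. l \<xi> * \<psi> \<xi>)"
      "(LINT x|lborel. complex_of_real (c * f x + d * h x) * schwartz_fourier \<psi> x) = (LINT \<xi>|lborel. l \<xi> * \<psi> \<xi>)"
      unfolding 1 2 using * by simp_all
  qed measurable
  moreover have "integrable lborel (\<lambda>\<xi>. (1 + \<xi>\<^sup>2) powr \<sigma> * (cmod (l \<xi>))\<^sup>2)"
  proof (rule Bochner_Integration.integrable_bound)
    show "integrable lborel (\<lambda>\<xi>. 2 * c\<^sup>2 * ((1 + \<xi>\<^sup>2) powr \<sigma> * (cmod (g \<xi>))\<^sup>2) +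
        2 * d\<^sup>2 * ((1 + \<xi>\<^sup>2) powr \<sigma> * (cmod (k \<xi>))\<^sup>2))"
      using gi ki by simp
    show "AE \<xi> in lborel. norm ((1 + \<xi>\<^sup>2) powr \<sigma> * (cmod (l \<xi>))\<^sup>2) \<le>
        norm (2 * c\<^sup>2 * ((1 + \<xi>\<^sup>2) powr \<sigma> * (cmod (g \<xi>))\<^sup>2) +
        2 * d\<^sup>2 * ((1 + \<xi>\<^sup>2) powr \<sigma> * (cmod (k \<xi>))\<^sup>2))"
    proof (rule AE_I2)
      fix \<xi> :: real
      have "(cmod (l \<xi>))\<^sup>2 \<le> (\<bar>c\<bar> * cmod (g \<xi>) + \<bar>d\<bar> * cmod (k \<xi>))\<^sup>2"
        unfolding l_def by (intro power_mono norm_triangle_le) (auto simp: norm_mult)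
      also have "\<dots> \<le> 2 * (\<bar>c\<bar> * cmod (g \<xi>))\<^sup>2 + 2 * (\<bar>d\<bar> * cmod (k \<xi>))\<^sup>2"
        using sum_squares_bound[of "\<bar>c\<bar> * cmod (g \<xi>)" "\<bar>d\<bar> * cmod (k \<xi>)"]
        by (simp add: power2_sum)
      finally have "(1 + \<xi>\<^sup>2) powr \<sigma> * (cmod (l \<xi>))\<^sup>2 \<le>
          (1 + \<xi>\<^sup>2) powr \<sigma> * (2 * (\<bar>c\<bar> * cmod (g \<xi>))\<^sup>2 + 2 * (\<bar>d\<bar> * cmod (k \<xi>))\<^sup>2)"
        by (intro mult_left_mono) auto
      then show "norm ((1 + \<xi>\<^sup>2) powr \<sigma> * (cmod (l \<xi>))\<^sup>2) \<le>
        norm (2 * c\<^sup>2 * ((1 + \<xi>\<^sup>2) powr \<sigma> * (cmod (g \<xi>))\<^sup>2) +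
        2 * d\<^sup>2 * ((1 + \<xi>\<^sup>2) powr \<sigma> * (cmod (k \<xi>))\<^sup>2))"
        by (simp add: power_mult_distrib algebra_simps)
    qed
  qed measurable
  ultimately show ?thesis unfolding sobolev_def by blast
qed

section \<open>Differential equations along characteristics\<close>

text \<open>Uniformity sends \<open>f \<tau> (g \<tau>) - l (g \<tau>)\<close> to 0 although the
  argument moves; continuity of \<open>l\<close> at \<open>a\<close> does the rest. In the
  applications \<open>g\<close> is a characteristic.\<close>

lemma uniform_limit_compose_tendsto:
  fixes f :: "'a \<Rightarrow> 'b::t2_space \<Rightarrow> 'c::real_normed_vector"
  assumes lim: "uniform_limit UNIV f l F" and g: "(g \<longlongrightarrow> a) F" and l: "isCont l a"
  shows "((\<lambda>\<tau>. f \<tau> (g \<tau>)) \<longlongrightarrow> l a) F"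
proof -
  have "((\<lambda>\<tau>. f \<tau> (g \<tau>) - l (g \<tau>)) \<longlongrightarrow> 0) F"
  proof (rule tendstoI)
    fix e :: real assume "e > 0"
    from uniform_limitD[OF lim this] show "\<forall>\<^sub>F \<tau> in F. dist (f \<tau> (g \<tau>) - l (g \<tau>)) 0 < e"
      by eventually_elim (simp add: dist_norm)
  qed
  from tendsto_add[OF this isCont_tendsto_compose[OF l g]] show ?thesis by simp
qed

text \<open>The increment is split at \<open>\<rho> t (\<gamma> \<tau>)\<close>. The time quotient
  is then evaluated at the moving point \<open>\<gamma> \<tau>\<close>, where uniform convergence is
  essential, and the remaining part is the ordinary chain rule for the fixed function
  \<open>\<rho> t\<close>.\<close>

lemma DERIV_along_curve:
  fixes \<rho> :: "real \<Rightarrow> real \<Rightarrow> real"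
  assumes lim: "uniform_limit UNIV (\<lambda>\<tau> x. (\<rho> \<tau> x - \<rho> t x) / (\<tau> - t)) \<rho>\<^sub>t (at t within S)"
    and cont: "isCont \<rho>\<^sub>t (\<gamma> t)"
    and \<rho>: "(\<rho> t has_real_derivative d) (at (\<gamma> t))"
    and \<gamma>: "(\<gamma> has_real_derivative v) (at t within S)"
  shows "((\<lambda>\<tau>. \<rho> \<tau> (\<gamma> \<tau>)) has_real_derivative \<rho>\<^sub>t (\<gamma> t) + d * v) (at t within S)"
proof -
  have "(\<gamma> \<longlongrightarrow> \<gamma> t) (at t within S)"
    using DERIV_continuous[OF \<gamma>] by (simp add: continuous_within)
  then have "((\<lambda>\<tau>. (\<rho> \<tau> (\<gamma> \<tau>) - \<rho> t (\<gamma> \<tau>)) / (\<tau> - t)) \<longlongrightarrow> \<rho>\<^sub>t (\<gamma> t)) (at t within S)"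
    by (rule uniform_limit_compose_tendsto[OF lim _ cont])
  moreover have "((\<lambda>\<tau>. (\<rho> t (\<gamma> \<tau>) - \<rho> t (\<gamma> t)) / (\<tau> - t)) \<longlongrightarrow> d * v) (at t within S)"
    using DERIV_chain2[OF \<rho> \<gamma>] by (simp add: has_field_derivative_iff)
  ultimately have "((\<lambda>\<tau>. (\<rho> \<tau> (\<gamma> \<tau>) - \<rho> t (\<gamma> \<tau>)) / (\<tau> - t) + (\<rho> t (\<gamma> \<tau>) - \<rho> t (\<gamma> t)) / (\<tau> - t))
      \<longlongrightarrow> \<rho>\<^sub>t (\<gamma> t) + d * v) (at t within S)"
    by (rule tendsto_add)
  then show ?thesis
    by (simp add: has_field_derivative_iff add_divide_distrib[symmetric])
qed

text \<open>The integrating factor \<open>exp (- c * integral {0..\<tau>} A)\<close> turns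
  \<open>R\<close> into a function with zero derivative.\<close>

lemma linear_ODE_solution:
  fixes R A :: "real \<Rightarrow> real"
  assumes t: "0 \<le> t" and A: "continuous_on {0..t} A"
    and R: "\<And>\<tau>. \<tau> \<in> {0..t} \<Longrightarrow> (R has_real_derivative c * A \<tau> * R \<tau>) (at \<tau> within {0..t})"
  shows "R t = R 0 * exp (c * integral {0..t} A)"
proof -
  have "((\<lambda>\<tau>. R \<tau> * exp (- c * integral {0..\<tau>} A)) has_real_derivative 0) (at \<tau> within {0..t})"
    if "\<tau> \<in> {0..t}" for \<tau>
    by (rule derivative_eq_intros R[OF that] integral_has_real_derivative[OF A that] refl)+ simp
  then obtain k where k: "\<forall>\<tau>\<in>{0..t}. R \<tau> * exp (- c * integral {0..\<tau>} A) = k"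
    using has_field_derivative_zero_constant[of "{0..t}" "\<lambda>\<tau>. R \<tau> * exp (- c * integral {0..\<tau>} A)"]
    by auto
  then have "R t * exp (- c * integral {0..t} A) = R 0"
    using k[rule_format, of 0] k[rule_format, of t] t by simp
  then have "R 0 * exp (c * integral {0..t} A) = R t * (exp (- c * integral {0..t} A) * exp (c * integral {0..t} A))"
    by (simp add: mult.assoc)
  also have "\<dots> = R t" by (simp add: mult_exp_exp)
  finally show ?thesis by simp
qed

lemma Gronwall_abs_bounds:
  fixes d d' :: "real \<Rightarrow> real"
  assumes t: "0 \<le> t"
    and d: "\<And>\<tau>. \<tau> \<in> {0..t} \<Longrightarrow> (d has_real_derivative d' \<tau>) (at \<tau> within {0..t})"
    and le: "\<And>\<tau>. \<tau> \<in> {0..t} \<Longrightarrow> \<bar>d' \<tau>\<bar> \<le> L * \<bar>d \<tau>\<bar>"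
  shows "\<bar>d 0\<bar> * exp (- L * t) \<le> \<bar>d t\<bar>" and "\<bar>d t\<bar> \<le> \<bar>d 0\<bar> * exp (L * t)"
proof -
  txt \<open>\<open>d\<^sup>2 exp (2 L \<tau>)\<close> increases and \<open>d\<^sup>2 exp (- 2 L \<tau>)\<close> decreases.\<close>
  have dd: "\<bar>d \<tau> * d' \<tau>\<bar> \<le> L * (d \<tau>)\<^sup>2" if "\<tau> \<in> {0..t}" for \<tau>
  proof -
    have "\<bar>d \<tau> * d' \<tau>\<bar> \<le> \<bar>d \<tau>\<bar> * (L * \<bar>d \<tau>\<bar>)"
      unfolding abs_mult by (intro mult_left_mono le that) simp
    then show ?thesis by (simp add: power2_eq_square algebra_simps)
  qed
  \<comment> \<open>The square is differentiable even where \<open>\<bar>d\<bar>\<close> is not.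
    \<open>K\<close> will be \<open>L\<close> for the lower bound and \<open>- L\<close> for the
    upper one.\<close>
  have der: "((\<lambda>\<tau>. (d \<tau>)\<^sup>2 * exp (2 * K * \<tau>)) has_real_derivative
      2 * (d \<tau> * d' \<tau> + K * (d \<tau>)\<^sup>2) * exp (2 * K * \<tau>)) (at \<tau> within {0..t})"
    if "\<tau> \<in> {0..t}" for \<tau> K
    by (rule derivative_eq_intros d[OF that] refl)+ (simp add: power2_eq_square algebra_simps)
  have cont: "continuous_on {0..t} (\<lambda>\<tau>. (d \<tau>)\<^sup>2 * exp (2 * K * \<tau>))" for K
    by (rule DERIV_continuous_on[OF der])
  have der': "DERIV (\<lambda>\<tau>. (d \<tau>)\<^sup>2 * exp (2 * K * \<tau>)) \<tau> :>
      2 * (d \<tau> * d' \<tau> + K * (d \<tau>)\<^sup>2) * exp (2 * K * \<tau>)" if "0 < \<tau>" "\<tau> < t" for \<tau> K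
    using der[of \<tau> K] that by (simp add: at_within_Icc_at)
  have "(d 0)\<^sup>2 * exp (2 * L * 0) \<le> (d t)\<^sup>2 * exp (2 * L * t)"
  proof (rule DERIV_nonneg_imp_increasing_open[OF t _ cont])
    fix \<tau> assume \<tau>: "0 < \<tau>" "\<tau> < t"
    have "0 \<le> 2 * (d \<tau> * d' \<tau> + L * (d \<tau>)\<^sup>2) * exp (2 * L * \<tau>)" using dd[of \<tau>] \<tau> by simp
    with der'[OF \<tau>, of L] show "\<exists>y. DERIV (\<lambda>\<tau>. (d \<tau>)\<^sup>2 * exp (2 * L * \<tau>)) \<tau> :> y \<and> 0 \<le> y" by blast
  qed
  also have "(d t)\<^sup>2 * exp (2 * L * t) = (\<bar>d t\<bar> * exp (L * t))\<^sup>2"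
    by (simp add: power_mult_distrib exp_double[symmetric] mult.assoc)
  finally have "\<bar>d 0\<bar> \<le> \<bar>d t\<bar> * exp (L * t)"
    by (simp add: abs_le_square_iff[symmetric] abs_mult)
  then have "\<bar>d 0\<bar> * exp (- L * t) \<le> \<bar>d t\<bar> * exp (L * t) * exp (- L * t)"
    by (rule mult_right_mono) simp
  then show "\<bar>d 0\<bar> * exp (- L * t) \<le> \<bar>d t\<bar>" by (simp add: mult.assoc mult_exp_exp)
  have "(d t)\<^sup>2 * exp (2 * (- L) * t) \<le> (d 0)\<^sup>2 * exp (2 * (- L) * 0)"
  proof (rule DERIV_nonpos_imp_decreasing_open[OF t _ cont])
    fix \<tau> assume \<tau>: "0 < \<tau>" "\<tau> < t"
    have "2 * (d \<tau> * d' \<tau> + - L * (d \<tau>)\<^sup>2) * exp (2 * (- L) * \<tau>) \<le> 0"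
      using dd[of \<tau>] \<tau> by (auto simp: mult_le_0_iff)
    with der'[OF \<tau>, of "- L"]
    show "\<exists>y. DERIV (\<lambda>\<tau>. (d \<tau>)\<^sup>2 * exp (2 * (- L) * \<tau>)) \<tau> :> y \<and> y \<le> 0" by blast
  qed
  moreover have "(d t)\<^sup>2 * exp (2 * (- L) * t) = (\<bar>d t\<bar> * exp (- L * t))\<^sup>2"
    by (simp add: power_mult_distrib exp_double[symmetric] mult.assoc)
  ultimately have "\<bar>d t\<bar> * exp (- L * t) \<le> \<bar>d 0\<bar>"
    by (simp add: abs_le_square_iff[symmetric] abs_mult)
  then have "\<bar>d t\<bar> * exp (- L * t) * exp (L * t) \<le> \<bar>d 0\<bar> * exp (L * t)"
    by (rule mult_right_mono) simp
  then show "\<bar>d t\<bar> \<le> \<bar>d 0\<bar> * exp (L * t)" by (simp add: mult.assoc mult_exp_exp)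
qed

text \<open>The lower Gronwall bound keeps two characteristics from meeting, so their order is
  preserved. At time \<open>t\<close> it also forces linear growth of \<open>\<phi> t\<close> in
  both directions, while the upper bound gives continuity; together they give surjectivity.\<close>

lemma lipschitz_flow_bij:
  fixes v \<phi> :: "real \<Rightarrow> real \<Rightarrow> real"
  assumes t: "0 \<le> t" and init: "\<And>x. \<phi> 0 x = x"
    and \<phi>: "\<And>\<tau> x. \<tau> \<in> {0..t} \<Longrightarrow> ((\<lambda>\<tau>. \<phi> \<tau> x) has_real_derivative v \<tau> (\<phi> \<tau> x)) (at \<tau> within {0..t})"
    and lip: "\<And>\<tau> x y. \<tau> \<in> {0..t} \<Longrightarrow> \<bar>v \<tau> x - v \<tau> y\<bar> \<le> L * \<bar>x - y\<bar>"
  shows "strict_mono (\<phi> t)" and "bij (\<phi> t)"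
proof -
  have d: "((\<lambda>\<tau>. \<phi> \<tau> y - \<phi> \<tau> x) has_real_derivative v \<tau> (\<phi> \<tau> y) - v \<tau> (\<phi> \<tau> x)) (at \<tau> within {0..t})"
    if "\<tau> \<in> {0..t}" for \<tau> x y
    using that by (intro DERIV_diff \<phi>)
  have low: "\<bar>y - x\<bar> * exp (- L * \<tau>) \<le> \<bar>\<phi> \<tau> y - \<phi> \<tau> x\<bar>"
    and up: "\<bar>\<phi> \<tau> y - \<phi> \<tau> x\<bar> \<le> \<bar>y - x\<bar> * exp (L * \<tau>)" if \<tau>: "\<tau> \<in> {0..t}" for \<tau> x y
  proof -
    have sub: "{0..\<tau>} \<subseteq> {0..t}" using \<tau> by auto
    note * = Gronwall_abs_bounds[of \<tau> "\<lambda>\<tau>. \<phi> \<tau> y - \<phi> \<tau> x" "\<lambda>\<tau>. v \<tau> (\<phi> \<tau> y) - v \<tau> (\<phi> \<tau> x)" L,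
        unfolded init]
    have 1: "0 \<le> \<tau>" using \<tau> by simp
    show "\<bar>y - x\<bar> * exp (- L * \<tau>) \<le> \<bar>\<phi> \<tau> y - \<phi> \<tau> x\<bar>"
      by (rule *(1)[OF 1]) (use sub lip DERIV_subset[OF d sub] in auto)
    show "\<bar>\<phi> \<tau> y - \<phi> \<tau> x\<bar> \<le> \<bar>y - x\<bar> * exp (L * \<tau>)"
      by (rule *(2)[OF 1]) (use sub lip DERIV_subset[OF d sub] in auto)
  qed
  have mono: "(y - x) * exp (- L * t) \<le> \<phi> t y - \<phi> t x" and less: "\<phi> t x < \<phi> t y" if xy: "x < y" for x y
  proof -
    have pos: "\<phi> t x < \<phi> t y"
    proof (rule ccontr)
      assume "\<not> ?thesis"
      moreover have "continuous_on {0..t} (\<lambda>\<tau>. \<phi> \<tau> y - \<phi> \<tau> x)" by (rule DERIV_continuous_on[OF d])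
      ultimately obtain \<tau> where \<tau>: "0 \<le> \<tau>" "\<tau> \<le> t" "\<phi> \<tau> y - \<phi> \<tau> x = 0"
        using IVT2'[of "\<lambda>\<tau>. \<phi> \<tau> y - \<phi> \<tau> x" t 0 0] t xy by (auto simp: init)
      with low[of \<tau> y x] xy show False by (auto simp: mult_le_0_iff)
    qed
    then show "\<phi> t x < \<phi> t y" .
    show "(y - x) * exp (- L * t) \<le> \<phi> t y - \<phi> t x"
      using low[of t y x] t xy pos by simp
  qed
  show sm: "strict_mono (\<phi> t)" using less by (simp add: strict_monoI)
  have "lipschitz_on (exp (L * t)) UNIV (\<phi> t)"
    using up[of t] t by (intro lipschitz_onI) (auto simp: dist_real_def mult.commute)
  then have cont: "continuous_on UNIV (\<phi> t)" by (rule lipschitz_on_continuous_on)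
  have "\<exists>x. \<phi> t x = z" for z
  proof -
    \<comment> \<open>\<open>Y\<close> is so large that the lower bound moves
      \<open>\<phi> t\<close> from its value at 0 beyond \<open>z\<close> on either side. The
      summand 1 ensures \<open>Y > 0\<close>, since \<open>mono\<close> compares distinct
      points.\<close>
    define Y where "Y = (\<bar>z - \<phi> t 0\<bar> + 1) * exp (L * t)"
    have Y: "Y > 0" by (simp add: Y_def add_nonneg_pos)
    have Ye: "Y * exp (- L * t) = \<bar>z - \<phi> t 0\<bar> + 1"
      by (simp add: Y_def mult.assoc mult_exp_exp)
    have "\<phi> t (- Y) \<le> z" using mono[of "- Y" 0] Y Ye by simp
    moreover have "z \<le> \<phi> t Y" using mono[of 0 Y] Y Ye by simp
    ultimately show ?thesis
      using IVT'[of "\<phi> t" "- Y" z Y] Y continuous_on_subset[OF cont] by auto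
  qed
  then have "surj (\<phi> t)" unfolding surj_def by metis
  then show "bij (\<phi> t)" using strict_mono_imp_inj_on[OF sm] by (simp add: bij_def)
qed

text \<open>Compactness of the time interval, in the form of bisection: near each \<open>t\<close>
  the bound \<open>B + 1\<close> holds by uniform convergence. Intervals shrinking to an endpoint
  may stick out, hence the intersection with \<open>{0..T}\<close>. Applied to
  \<open>u\<^sub>x\<close>, this gives one Lipschitz constant for the whole time interval.\<close>

lemma uniformly_continuous_family_bounded_on_Icc:
  fixes f :: "real \<Rightarrow> 'a \<Rightarrow> real"
  assumes lim: "\<And>t. t \<in> {0..T} \<Longrightarrow> uniform_limit UNIV f (f t) (at t within {0..T})"
    and bdd: "\<And>t. t \<in> {0..T} \<Longrightarrow> \<exists>B. \<forall>x. \<bar>f t x\<bar> \<le> B"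
    and T: "0 \<le> T"
  shows "\<exists>B. \<forall>t\<in>{0..T}. \<forall>x. \<bar>f t x\<bar> \<le> B"
proof -
  have "\<exists>B. \<forall>t\<in>{0..T} \<inter> {0..T}. \<forall>x. \<bar>f t x\<bar> \<le> B"
    using T
  proof (induction rule: Bolzano[where P = "\<lambda>a b. \<exists>B. \<forall>t\<in>{a..b} \<inter> {0..T}. \<forall>x. \<bar>f t x\<bar> \<le> B"])
    case (trans a b c)
    then obtain B C where "\<forall>t\<in>{a..b} \<inter> {0..T}. \<forall>x. \<bar>f t x\<bar> \<le> B" "\<forall>t\<in>{b..c} \<inter> {0..T}. \<forall>x. \<bar>f t x\<bar> \<le> C"
      by auto
    then have "\<forall>t\<in>{a..c} \<inter> {0..T}. \<forall>x. \<bar>f t x\<bar> \<le> max B C"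
      by (auto simp: le_max_iff_disj)
    then show ?case by blast
  next
    case (local t)
    then have t: "t \<in> {0..T}" by simp
    from bdd[OF t] obtain B where B: "\<And>x. \<bar>f t x\<bar> \<le> B" by blast
    from uniform_limitD[OF lim[OF t], of 1]
    obtain \<delta> where \<delta>: "\<delta> > 0" "\<And>\<tau> x. \<tau> \<in> {0..T} \<Longrightarrow> \<tau> \<noteq> t \<Longrightarrow> dist \<tau> t < \<delta> \<Longrightarrow> dist (f \<tau> x) (f t x) < 1"
      by (auto simp: eventually_at)
    have "\<bar>f \<tau> x\<bar> \<le> B + 1" if "\<tau> \<in> {0..T}" "dist \<tau> t < \<delta>" for \<tau> x
    proof (cases "\<tau> = t")
      case True
      then show ?thesis using B[of x] by simp
    next
      case False
      then show ?thesis using \<delta>(2)[OF that(1) False that(2), of x] B[of x] by (simp add: dist_real_def)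
    qed
    then have "\<forall>\<tau>\<in>{a..b} \<inter> {0..T}. \<forall>x. \<bar>f \<tau> x\<bar> \<le> B + 1" if "a \<le> t" "t \<le> b" "b - a < \<delta>" for a b
      using that by (auto simp: dist_real_def)
    then show ?case using \<delta>(1) by blast
  qed
  then show ?thesis by simp
qed

section \<open>From Sobolev continuity in time to uniform convergence in x\<close>

lemma C0_sobolev_uniform_limit_deriv:
  assumes \<sigma>: "\<sigma> > 3 / 2" and w: "C0_sobolev \<sigma> I w" and t: "t \<in> I"
    and cont: "\<And>t. t \<in> I \<Longrightarrow> continuous_on UNIV (w t)"
  shows "uniform_limit UNIV (\<lambda>\<tau>. deriv (w \<tau>)) (deriv (w t)) (at t within I)"
proof (rule uniform_limitI)
  fix e :: real assume e: "e > 0"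
  have ws: "w \<tau> \<in> sobolev \<sigma>" if "\<tau> \<in> I" for \<tau>
    using w that by (simp add: C0_sobolev_def)
  define N where "N \<tau> = sobolev_const (\<sigma> - 1) * sobolev_norm \<sigma> (\<lambda>x. w \<tau> x - w t x)" for \<tau>
  have "(N \<longlongrightarrow> sobolev_const (\<sigma> - 1) * 0) (at t within I)"
    unfolding N_def using w t by (intro tendsto_intros) (simp add: C0_sobolev_def)
  then have "\<forall>\<^sub>F \<tau> in at t within I. N \<tau> < e"
    using e by (intro order_tendstoD) auto
  moreover have "\<forall>\<^sub>F \<tau> in at t within I. \<tau> \<in> I"
    by (simp add: eventually_at_filter)
  ultimately show "\<forall>\<^sub>F \<tau> in at t within I. \<forall>x\<in>UNIV. dist (deriv (w \<tau>) x) (deriv (w t) x) < e"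
  proof eventually_elim
    case (elim \<tau>)
    \<comment> \<open>The derivative bound is applied to the difference of two times, whose
      derivative is the difference of the derivatives.\<close>
    have sob: "(\<lambda>x. w \<tau> x - w t x) \<in> sobolev \<sigma>"
      using sobolev_lincomb[OF ws ws, of \<tau> t 1 "-1"] elim t by simp
    show ?case
    proof
      fix x
      have "((\<lambda>x. w \<tau> x - w t x) has_real_derivative deriv (w \<tau>) x - deriv (w t) x) (at x)"
        using elim t by (intro DERIV_diff sobolev_C1(1)[OF \<sigma>] ws cont)
      moreover have "\<bar>deriv (\<lambda>x. w \<tau> x - w t x) x\<bar> \<le> N \<tau>"
        unfolding N_def using elim t by (intro sobolev_C1(3)[OF \<sigma> sob] continuous_intros cont)
      ultimately show "dist (deriv (w \<tau>) x) (deriv (w t) x) < e"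
        using elim by (simp add: dist_real_def DERIV_imp_deriv)
    qed
  qed
qed

text \<open>The sup bound is applied to the remainder of the difference quotient. It speaks of
  continuous functions only, so \<open>w' t\<close> has to be the continuous representative.\<close>

lemma C1_sobolev_uniform_limit:
  assumes \<sigma>: "\<sigma> > 1 / 2" and w: "C1_sobolev \<sigma> I w w'" and t: "t \<in> I"
    and cont: "\<And>t. t \<in> I \<Longrightarrow> continuous_on UNIV (w t)" and cont': "continuous_on UNIV (w' t)"
  shows "uniform_limit UNIV (\<lambda>\<tau> x. (w \<tau> x - w t x) / (\<tau> - t)) (w' t) (at t within I)"
proof (rule uniform_limitI)
  fix e :: real assume e: "e > 0"
  have ws: "w \<tau> \<in> sobolev \<sigma>" "w' \<tau> \<in> sobolev \<sigma>" if "\<tau> \<in> I" for \<tau>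
    using w that by (simp_all add: C1_sobolev_def C0_sobolev_def)
  define N where
    "N \<tau> = sobolev_const \<sigma> * sobolev_norm \<sigma> (\<lambda>x. (w \<tau> x - w t x) / (\<tau> - t) - w' t x)" for \<tau>
  have "(N \<longlongrightarrow> sobolev_const \<sigma> * 0) (at t within I)"
    unfolding N_def using w t by (intro tendsto_intros) (simp add: C1_sobolev_def)
  then have "\<forall>\<^sub>F \<tau> in at t within I. N \<tau> < e"
    using e by (intro order_tendstoD) auto
  moreover have "\<forall>\<^sub>F \<tau> in at t within I. \<tau> \<in> I \<and> \<tau> \<noteq> t"
    by (simp add: eventually_at_filter)
  ultimately show "\<forall>\<^sub>F \<tau> in at t within I. \<forall>x\<in>UNIV. dist ((w \<tau> x - w t x) / (\<tau> - t)) (w' t x) < e"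
  proof eventually_elim
    case (elim \<tau>)
    have "(\<lambda>x. (w \<tau> x - w t x) / (\<tau> - t) - w' t x) \<in> sobolev \<sigma>"
      using sobolev_lincomb[OF sobolev_lincomb[OF ws(1) ws(1), of \<tau> t "1 / (\<tau> - t)" "- 1 / (\<tau> - t)"] ws(2),
          of t 1 "-1"] elim t
      by (simp add: diff_divide_distrib)
    moreover have "continuous_on UNIV (\<lambda>x. (w \<tau> x - w t x) / (\<tau> - t) - w' t x)"
      using elim t by (intro continuous_intros cont cont') auto
    ultimately have "\<bar>(w \<tau> x - w t x) / (\<tau> - t) - w' t x\<bar> \<le> N \<tau>" for x
      unfolding N_def by (rule sobolev_sup_bound[OF \<sigma>])
    with elim show ?case by (auto simp: dist_real_def intro: le_less_trans)
  qed
qed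

section \<open>Transport of \<open>\<rho>\<close> and of its support\<close>

theorem corollary3p1:
  fixes r b \<kappa> s :: real and T :: ereal
    and \<alpha> u\<^sub>0 \<rho>\<^sub>0 :: "real \<Rightarrow> real"
    and u \<rho> \<phi> :: "real \<Rightarrow> real \<Rightarrow> real"
  assumes "r \<ge> 1" and "s > 2 * r + 1 / 2"
    and "(\<exists>c. \<alpha> = (\<lambda>_. c)) \<or> \<alpha> \<in> sobolev (s - 2 * r)"
    and "u\<^sub>0 \<in> sobolev s" and "\<rho>\<^sub>0 \<in> sobolev (s - 2 * r + 1)"
    and "maximal_cauchy_solution r b \<kappa> s \<alpha> u\<^sub>0 \<rho>\<^sub>0 T u \<rho>"
    and "is_flow T u \<phi>"
  shows "(\<forall>t\<in>lifespan T. \<forall>x.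
            \<rho> t x = \<rho>\<^sub>0 (inv (\<phi> t) x) *
              exp ((1 - b) * integral {0..t} (\<lambda>\<tau>. deriv (u \<tau>) (\<phi> \<tau> (inv (\<phi> t) x))))) \<and>
         (\<forall>\<beta> \<gamma>. supp \<rho>\<^sub>0 \<subseteq> {\<beta>..\<gamma>} \<longrightarrow>
            (\<forall>t\<in>lifespan T. compact (supp (\<rho> t)) \<and> supp (\<rho> t) \<subseteq> {\<phi> t \<beta>..\<phi> t \<gamma>}))"
proof -
  define I where "I = lifespan T"
  have "cauchy_solution r b \<kappa> s \<alpha> u\<^sub>0 \<rho>\<^sub>0 T u \<rho>"
    using assms(6) unfolding maximal_cauchy_solution_def by (elim conjE)
  then obtain \<rho>\<^sub>t where u: "C0_sobolev s I u"
    and \<rho>: "C0_sobolev (s - 2 * r + 1) I \<rho>" and \<rho>\<^sub>t: "C1_sobolev (s - 2 * r) I \<rho> \<rho>\<^sub>t"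
    and cu: "\<And>t. t \<in> I \<Longrightarrow> continuous_on UNIV (u t)"
    and c\<rho>: "\<And>t. t \<in> I \<Longrightarrow> continuous_on UNIV (\<rho> t)"
    and eq: "\<And>t x. t \<in> I \<Longrightarrow> \<rho>\<^sub>t t x = - u t x * deriv (\<rho> t) x - (b - 1) * deriv (u t) x * \<rho> t x"
    and \<rho>0: "\<And>x. \<rho> 0 x = \<rho>\<^sub>0 x"
    unfolding cauchy_solution_def I_def[symmetric] by (elim exE conjE) simp
  \<comment> \<open>The orders needed for the x-derivative of \<open>u\<close>, the x-derivative of
    \<open>\<rho>\<close>, and the time derivative of \<open>\<rho>\<close>.\<close>
  have s: "s > 3 / 2" "s - 2 * r + 1 > 3 / 2" "s - 2 * r > 1 / 2"
    using assms(1,2) by auto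
  have us: "u t \<in> sobolev s" and \<rho>s: "\<rho> t \<in> sobolev (s - 2 * r + 1)" if "t \<in> I" for t
    using u \<rho> that by (auto simp: C0_sobolev_def)
  note uC1 = sobolev_C1[OF s(1) us cu] and \<rho>C1 = sobolev_C1[OF s(2) \<rho>s c\<rho>]
  have isCont: "isCont f x" if "continuous_on UNIV f" for f :: "real \<Rightarrow> real" and x
    using that by (simp add: continuous_on_eq_continuous_at)
  \<comment> \<open>A solution comes with continuity in x of \<open>u t\<close> and
    \<open>\<rho> t\<close> only; for \<open>\<rho>\<^sub>t t\<close> it is read off from the
    equation.\<close>
  have c\<rho>\<^sub>t: "continuous_on UNIV (\<rho>\<^sub>t t)" if "t \<in> I" for t
  proof -
    have "\<rho>\<^sub>t t = (\<lambda>x. - u t x * deriv (\<rho> t) x - (b - 1) * deriv (u t) x * \<rho> t x)"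
      using eq[OF that] by (rule ext)
    then show ?thesis
      by (simp only:) (intro continuous_intros cu c\<rho> uC1(2) \<rho>C1(2) that)
  qed
  have init: "\<phi> 0 x = x" for x using assms(7) by (simp add: is_flow_def)
  have \<phi>: "((\<lambda>\<tau>. \<phi> \<tau> x) has_real_derivative u t (\<phi> t x)) (at t within I)" if "t \<in> I" for t x
    using assms(7) that by (simp add: is_flow_def I_def)
  have sub: "{0..t} \<subseteq> I" if "t \<in> I" for t
    using that unfolding I_def lifespan_def by (auto intro: le_less_trans[where y = "ereal t"])
  have ulim: "uniform_limit UNIV (\<lambda>\<tau>. deriv (u \<tau>)) (deriv (u t)) (at t within I)" if "t \<in> I" for t
    by (rule C0_sobolev_uniform_limit_deriv[OF s(1) u that cu])
  have bij: "strict_mono (\<phi> t) \<and> bij (\<phi> t)" if t: "t \<in> I" for t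
  proof -
    note S = sub[OF t]
    have t0: "0 \<le> t" using t by (simp add: I_def lifespan_def)
    have "\<exists>B. \<forall>\<tau>\<in>{0..t}. \<forall>x. \<bar>deriv (u \<tau>) x\<bar> \<le> B"
    proof (rule uniformly_continuous_family_bounded_on_Icc[OF _ _ t0])
      fix \<tau> assume "\<tau> \<in> {0..t}"
      then have \<tau>: "\<tau> \<in> I" using S by auto
      show "uniform_limit UNIV (\<lambda>\<tau>. deriv (u \<tau>)) (deriv (u \<tau>)) (at \<tau> within {0..t})"
        by (rule filterlim_mono[OF ulim[OF \<tau>] order_refl at_le[OF S]])
      show "\<exists>B. \<forall>x. \<bar>deriv (u \<tau>) x\<bar> \<le> B" using uC1(3)[OF \<tau> \<tau>] by blast
    qed
    then obtain L where L: "\<And>\<tau> x. \<tau> \<in> {0..t} \<Longrightarrow> \<bar>deriv (u \<tau>) x\<bar> \<le> L" by blast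
    \<comment> \<open>The mean value theorem, with \<open>L\<close> independent of both time and
      position.\<close>
    have lip: "\<bar>u \<tau> x - u \<tau> y\<bar> \<le> L * \<bar>x - y\<bar>" if "\<tau> \<in> {0..t}" for \<tau> x y
      using field_differentiable_bound[of UNIV "u \<tau>" "deriv (u \<tau>)" L x y] uC1(1)[of \<tau>] L[OF that] S that
      by (auto simp: subset_iff)
    have d: "((\<lambda>\<tau>. \<phi> \<tau> x) has_real_derivative u \<tau> (\<phi> \<tau> x)) (at \<tau> within {0..t})" if "\<tau> \<in> {0..t}" for \<tau> x
      using DERIV_subset[OF \<phi> S] S that by auto
    show ?thesis using lipschitz_flow_bij[OF t0 init d lip] by blast
  qed
  have rep: "\<rho> t (\<phi> t y) = \<rho>\<^sub>0 y * exp ((1 - b) * integral {0..t} (\<lambda>\<tau>. deriv (u \<tau>) (\<phi> \<tau> y)))"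
    if t: "t \<in> I" for t y
  proof -
    note S = sub[OF t]
    have t0: "0 \<le> t" using t by (simp add: I_def lifespan_def)
    have "\<rho> t (\<phi> t y) = \<rho> 0 (\<phi> 0 y) * exp ((1 - b) * integral {0..t} (\<lambda>\<tau>. deriv (u \<tau>) (\<phi> \<tau> y)))"
    proof (rule linear_ODE_solution[where R = "\<lambda>\<tau>. \<rho> \<tau> (\<phi> \<tau> y)"
            and A = "\<lambda>\<tau>. deriv (u \<tau>) (\<phi> \<tau> y)", OF t0])
      \<comment> \<open>Time and position vary together here, so uniform convergence of
        \<open>deriv (u \<tau>)\<close> in x is used along the characteristic.\<close>
      have "((\<lambda>\<tau>. deriv (u \<tau>) (\<phi> \<tau> y)) \<longlongrightarrow> deriv (u \<tau>) (\<phi> \<tau> y)) (at \<tau> within I)" if \<tau>: "\<tau> \<in> I" for \<tau>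
        using DERIV_continuous[OF \<phi>[OF \<tau>, of y]]
        by (intro uniform_limit_compose_tendsto[OF ulim[OF \<tau>] _ isCont[OF uC1(2)[OF \<tau> \<tau>]]])
          (simp add: continuous_within)
      then have "continuous_on I (\<lambda>\<tau>. deriv (u \<tau>) (\<phi> \<tau> y))"
        by (simp add: continuous_on_def)
      then show "continuous_on {0..t} (\<lambda>\<tau>. deriv (u \<tau>) (\<phi> \<tau> y))"
        by (rule continuous_on_subset[OF _ S])
      fix \<tau> assume "\<tau> \<in> {0..t}"
      then have \<tau>: "\<tau> \<in> I" using S by auto
      have "((\<lambda>\<tau>. \<rho> \<tau> (\<phi> \<tau> y)) has_real_derivative
          \<rho>\<^sub>t \<tau> (\<phi> \<tau> y) + deriv (\<rho> \<tau>) (\<phi> \<tau> y) * u \<tau> (\<phi> \<tau> y)) (at \<tau> within I)"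
        by (rule DERIV_along_curve[OF C1_sobolev_uniform_limit[OF s(3) \<rho>\<^sub>t \<tau> c\<rho> c\<rho>\<^sub>t[OF \<tau>]]
              isCont[OF c\<rho>\<^sub>t[OF \<tau>]] \<rho>C1(1)[OF \<tau> \<tau>] \<phi>[OF \<tau>]])
      \<comment> \<open>Inserting the equation for \<open>\<rho>\<^sub>t\<close> cancels the
        transport term \<open>u * \<rho>\<^sub>x\<close> and leaves the factor
        \<open>1 - b\<close>.\<close>
      then show "((\<lambda>\<tau>. \<rho> \<tau> (\<phi> \<tau> y)) has_real_derivative
          (1 - b) * deriv (u \<tau>) (\<phi> \<tau> y) * \<rho> \<tau> (\<phi> \<tau> y)) (at \<tau> within {0..t})"
        using eq[OF \<tau>] by (auto simp: algebra_simps intro: DERIV_subset[OF _ S])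
    qed
    then show ?thesis by (simp add: init \<rho>0)
  qed
  have inv: "\<phi> t (inv (\<phi> t) x) = x" if "t \<in> I" for t x
    using bij[OF that] by (simp add: bij_is_surj surj_f_inv_f)
  have rep': "\<rho> t x = \<rho>\<^sub>0 (inv (\<phi> t) x) *
      exp ((1 - b) * integral {0..t} (\<lambda>\<tau>. deriv (u \<tau>) (\<phi> \<tau> (inv (\<phi> t) x))))" if "t \<in> I" for t x
    using rep[OF that, of "inv (\<phi> t) x"] by (simp add: inv[OF that])
  have "compact (supp (\<rho> t)) \<and> supp (\<rho> t) \<subseteq> {\<phi> t \<beta>..\<phi> t \<gamma>}"
    if \<rho>\<^sub>0: "supp \<rho>\<^sub>0 \<subseteq> {\<beta>..\<gamma>}" and t: "t \<in> I" for t \<beta> \<gamma>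
  proof -
    \<comment> \<open>The interval is closed, so it contains the support as soon as it contains the
      points where \<open>\<rho> t\<close> is nonzero.\<close>
    have "x \<in> {\<phi> t \<beta>..\<phi> t \<gamma>}" if "\<rho> t x \<noteq> 0" for x
    proof -
      have "\<rho>\<^sub>0 (inv (\<phi> t) x) \<noteq> 0" using that rep'[OF t, of x] by auto
      then have "inv (\<phi> t) x \<in> supp \<rho>\<^sub>0"
        unfolding supp_def by (intro subsetD[OF closure_subset]) simp
      then have "inv (\<phi> t) x \<in> {\<beta>..\<gamma>}"
        using \<rho>\<^sub>0 by (rule subsetD[rotated])
      then have "\<phi> t \<beta> \<le> \<phi> t (inv (\<phi> t) x) \<and> \<phi> t (inv (\<phi> t) x) \<le> \<phi> t \<gamma>"
        using bij[OF t] by (simp add: strict_mono_less_eq)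
      then show ?thesis by (simp add: inv[OF t])
    qed
    then have "supp (\<rho> t) \<subseteq> {\<phi> t \<beta>..\<phi> t \<gamma>}"
      unfolding supp_def by (intro closure_minimal) auto
    moreover from this have "compact (supp (\<rho> t))"
      unfolding supp_def by (meson bounded_closed_interval bounded_subset closed_closure compact_eq_bounded_closed)
    ultimately show ?thesis by blast
  qed
  with rep' show ?thesis unfolding I_def by blast
qed

end
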